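(* Let $d\ge2$, let $\rho=\rho^{Q_1\cdots Q_n}$ be a state on $n$ qudits of dimension $d$, and let $k\le n$. Let $\Lambda$ be a measurement on $\mathbb{C}^d$ with at most $d^8$ outcomes such that $\|\xi\|_1\le(18d)^{k'/2}\|\Lambda^{\otimes k'}(\xi)\|_1$ for every positive integer $k'$ and every traceless Hermitian $\xi$ on $(\mathbb{C}^d)^{\otimes k'}$. For every integer $t\le n-k$ there is an integer $m\le t$ such that the following holds. Let $\vec i=(i_1,\ldots,i_k)$ and $\vec j=(j_1,\ldots,j_m)$ be random disjoint ordered subsets of $[n]$, and let $\vec x=(x_1,\ldots,x_m)$ be the measurement outcomes resulting from applying $\Lambda^{\otimes m}$ to $Q_{j_1}\cdots Q_{j_m}$ of $\rho$. Let $\rho_{\vec j,\vec x}$ be the post-measurement state conditioned on obtaining outcomes $\vec x$. Then $$\mathbb{E}_{\vec j,\vec x}\,\mathbb{E}_{\vec i}\left\|\rho^{Q_{i_1}\cdots Q_{i_k}}_{\vec j,\vec x}-\rho^{Q_{i_1}}_{\vec j,\vec x}\otimes\cdots\otimes\rho^{Q_{i_k}}_{\vec j,\vec x}\right\|_1^2\le\frac{4\ln(d)(18d)^kk^2}{t}.$$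
   Context: A measurement is the channel $\Lambda(\rho)=\sum_x\operatorname{tr}(M_x\rho)|x\rangle\langle x|$ for a POVM $\{M_x\}$ ($M_x\ge0$, $\sum_xM_x=I$). Random disjoint ordered subsets are uniformly random tuples of distinct indices sharing no index; $\vec x$ is distributed according to the outcome distribution of the measurement. Superscripts denote reduced states and $\|\cdot\|_1$ is the trace norm. *)

theory Defs
  imports Complex_Main
begin

text \<open>An operator on the Hilbert space with orthonormal basis indexed by the finite set I
  is represented by its matrix entries A a b for a, b in I (entries outside I are ignored).\<close>

definition mmul :: "'i set \<Rightarrow> ('i \<Rightarrow> 'i \<Rightarrow> complex) \<Rightarrow> ('i \<Rightarrow> 'i \<Rightarrow> complex) \<Rightarrow> ('i \<Rightarrow> 'i \<Rightarrow> complex)" where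
  "mmul I A B = (\<lambda>a c. \<Sum>b\<in>I. A a b * B b c)"

definition adj :: "('i \<Rightarrow> 'i \<Rightarrow> complex) \<Rightarrow> ('i \<Rightarrow> 'i \<Rightarrow> complex)" where
  "adj A = (\<lambda>a b. cnj (A b a))"

definition trace :: "'i set \<Rightarrow> ('i \<Rightarrow> 'i \<Rightarrow> complex) \<Rightarrow> complex" where
  "trace I A = (\<Sum>a\<in>I. A a a)"

definition herm :: "'i set \<Rightarrow> ('i \<Rightarrow> 'i \<Rightarrow> complex) \<Rightarrow> bool" where
  "herm I A \<longleftrightarrow> (\<forall>a\<in>I. \<forall>b\<in>I. A a b = cnj (A b a))"

definition psd :: "'i set \<Rightarrow> ('i \<Rightarrow> 'i \<Rightarrow> complex) \<Rightarrow> bool" where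
  "psd I A \<longleftrightarrow> herm I A \<and>
     (\<forall>v :: 'i \<Rightarrow> complex. 0 \<le> Re (\<Sum>a\<in>I. \<Sum>b\<in>I. cnj (v a) * A a b * v b))"

definition opsqrt :: "'i set \<Rightarrow> ('i \<Rightarrow> 'i \<Rightarrow> complex) \<Rightarrow> ('i \<Rightarrow> 'i \<Rightarrow> complex)" where
  "opsqrt I A = (THE B. psd I B \<and> (\<forall>a b. (a \<notin> I \<or> b \<notin> I) \<longrightarrow> B a b = 0) \<and>
                         (\<forall>a\<in>I. \<forall>b\<in>I. mmul I B B a b = A a b))"

definition trace_norm :: "'i set \<Rightarrow> ('i \<Rightarrow> 'i \<Rightarrow> complex) \<Rightarrow> real" where
  "trace_norm I A = Re (trace I (opsqrt I (mmul I (adj A) A)))"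

text \<open>Computational basis of k qudits of dimension d: lists of length k with entries < d.\<close>
definition cube :: "nat \<Rightarrow> nat \<Rightarrow> nat list set" where
  "cube k d = {xs. length xs = k \<and> (\<forall>x\<in>set xs. x < d)}"

definition is_state :: "nat \<Rightarrow> nat \<Rightarrow> (nat list \<Rightarrow> nat list \<Rightarrow> complex) \<Rightarrow> bool" where
  "is_state d n \<rho> \<longleftrightarrow> psd (cube n d) \<rho> \<and> trace (cube n d) \<rho> = 1"

definition is_povm :: "nat \<Rightarrow> nat \<Rightarrow> (nat \<Rightarrow> nat \<Rightarrow> nat \<Rightarrow> complex) \<Rightarrow> bool" where
  "is_povm d N M \<longleftrightarrow> (\<forall>x<N. psd {..<d} (M x)) \<and>
     (\<forall>a<d. \<forall>b<d. (\<Sum>x<N. M x a b) = (if a = b then 1 else 0))"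

definition tensorl :: "(nat \<Rightarrow> nat \<Rightarrow> complex) list \<Rightarrow> (nat list \<Rightarrow> nat list \<Rightarrow> complex)" where
  "tensorl Ms = (\<lambda>a b. \<Prod>l<length Ms. (Ms ! l) (a ! l) (b ! l))"

definition meas_channel :: "nat \<Rightarrow> nat \<Rightarrow> (nat \<Rightarrow> nat \<Rightarrow> nat \<Rightarrow> complex) \<Rightarrow> nat \<Rightarrow>
    (nat list \<Rightarrow> nat list \<Rightarrow> complex) \<Rightarrow> (nat list \<Rightarrow> nat list \<Rightarrow> complex)" where
  "meas_channel d N M k \<xi> = (\<lambda>xs ys. if xs = ys
      then trace (cube k d) (mmul (cube k d) (tensorl (map M xs)) \<xi>) else 0)"

text \<open>marg d n js Ms is \<rho>: apply (Ms!0 \<otimes> ... ) on qudits js (i.e. form (M \<otimes> I) \<rho>),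
  then take the partial trace over all qudits except those in the ordered tuple is,
  which are arranged in the order given by is.  With js = [] this is the reduced state
  \<open>\<rho>^{Q_{i_1}...Q_{i_k}}\<close>; with is = [] it is the scalar tr((M \<otimes> I)\<rho>).\<close>
definition marg :: "nat \<Rightarrow> nat \<Rightarrow> nat list \<Rightarrow> (nat \<Rightarrow> nat \<Rightarrow> complex) list \<Rightarrow> nat list \<Rightarrow>
    (nat list \<Rightarrow> nat list \<Rightarrow> complex) \<Rightarrow> (nat list \<Rightarrow> nat list \<Rightarrow> complex)" where
  "marg d n js Ms is \<rho> = (\<lambda>a b. \<Sum>c\<in>cube n d. \<Sum>c'\<in>cube n d.
      if (\<forall>l<length is. c ! (is ! l) = a ! l \<and> c' ! (is ! l) = b ! l) \<and>
         (\<forall>q<n. q \<notin> set is \<and> q \<notin> set js \<longrightarrow> c ! q = c' ! q)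
      then (\<Prod>l<length js. (Ms ! l) (c' ! (js ! l)) (c ! (js ! l))) * \<rho> c c'
      else 0)"

definition outcome_prob :: "nat \<Rightarrow> nat \<Rightarrow> (nat \<Rightarrow> nat \<Rightarrow> nat \<Rightarrow> complex) \<Rightarrow> nat list \<Rightarrow> nat list \<Rightarrow>
    (nat list \<Rightarrow> nat list \<Rightarrow> complex) \<Rightarrow> real" where
  "outcome_prob d n M js xs \<rho> = Re (marg d n js (map M xs) [] \<rho> [] [])"

definition post_red :: "nat \<Rightarrow> nat \<Rightarrow> (nat \<Rightarrow> nat \<Rightarrow> nat \<Rightarrow> complex) \<Rightarrow> nat list \<Rightarrow> nat list \<Rightarrow>
    nat list \<Rightarrow> (nat list \<Rightarrow> nat list \<Rightarrow> complex) \<Rightarrow> (nat list \<Rightarrow> nat list \<Rightarrow> complex)" where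
  "post_red d n M js xs is \<rho> =
     (\<lambda>a b. marg d n js (map M xs) is \<rho> a b / complex_of_real (outcome_prob d n M js xs \<rho>))"

definition post_red1 :: "nat \<Rightarrow> nat \<Rightarrow> (nat \<Rightarrow> nat \<Rightarrow> nat \<Rightarrow> complex) \<Rightarrow> nat list \<Rightarrow> nat list \<Rightarrow>
    nat \<Rightarrow> (nat list \<Rightarrow> nat list \<Rightarrow> complex) \<Rightarrow> (nat \<Rightarrow> nat \<Rightarrow> complex)" where
  "post_red1 d n M js xs i \<rho> = (\<lambda>x y. post_red d n M js xs [i] \<rho> [x] [y])"

definition tuples :: "nat \<Rightarrow> nat \<Rightarrow> nat set \<Rightarrow> nat list set" where
  "tuples n k E = {is. length is = k \<and> distinct is \<and> set is \<subseteq> {..<n} - E}"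

definition deviation :: "nat \<Rightarrow> nat \<Rightarrow> (nat \<Rightarrow> nat \<Rightarrow> nat \<Rightarrow> complex) \<Rightarrow> nat list \<Rightarrow> nat list \<Rightarrow>
    nat list \<Rightarrow> (nat list \<Rightarrow> nat list \<Rightarrow> complex) \<Rightarrow> real" where
  "deviation d n M js xs is \<rho> = trace_norm (cube (length is) d)
     (\<lambda>a b. post_red d n M js xs is \<rho> a b
            - tensorl (map (\<lambda>i. post_red1 d n M js xs i \<rho>) is) a b)"

definition avg_dev_sq :: "nat \<Rightarrow> nat \<Rightarrow> nat \<Rightarrow> nat \<Rightarrow> (nat \<Rightarrow> nat \<Rightarrow> nat \<Rightarrow> complex) \<Rightarrow> nat \<Rightarrow>
    (nat list \<Rightarrow> nat list \<Rightarrow> complex) \<Rightarrow> real" where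
  "avg_dev_sq d n k N M m \<rho> =
     (\<Sum>js\<in>tuples n m {}. \<Sum>xs\<in>cube m N. outcome_prob d n M js xs \<rho> *
        ((\<Sum>is\<in>tuples n k (set js). (deviation d n M js xs is \<rho>)\<^sup>2)
           / real (card (tuples n k (set js)))))
     / real (card (tuples n m {}))"

end

(*
  Measuring all qudits turns rho into a classical distribution on [N]^n.  Let f(m) be the average
  conditional entropy H(X_i | X_{j_1}, ..., X_{j_m}) over random distinct indices.  The chain rule
  makes the average multipartite information of k outcomes, conditioned on m others, equal to the
  sum of f(m) - f(m + l) over l < k; summed over m < t this telescopes to at most k^2 terms of the
  form f(m) - f(m').  Each of these is at most ln d: relative to the reference weights
  q(y) = tr(M_y) / d every conditional law p satisfies p <= d q (because M_y <= tr(M_y) I), while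
  Gibbs' inequality bounds the entropy by the cross entropy.  Hence some m < t has average
  information at most k^2 ln(d) / t.  A Hellinger-type bound (sum |p - q|)^2 <= 4 KL(p, q) and the
  distinguishability hypothesis on the measurement finish the proof.
*)

theory Submission
  imports Defs "HOL-Analysis.Convex" "HOL-Analysis.Topology_Euclidean_Space"
begin

subsection \<open>Positive semidefinite matrices\<close>

text \<open>The outcomes of every choice of measured qudits are marginals of one law on [N]^n, since
  summing the factor of an unmeasured qudit over all outcomes gives the identity. Operators
  therefore enter at few places: traces of positive product operators against the state are
  nonnegative, \<open>M_y \<le> tr(M_y) I\<close> yields the domination, and the distinguishability
  hypothesis turns l1 distances back into trace norms. What lies between is classical. The constant
  is ln d, not the logarithm of the number of outcomes, because \<open>f(m)\<close> is trapped
  between c - ln d and c, where c is the average cross entropy. Each entry of a uniformly random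
  tuple is uniform, so c is the same for all m and cancels in \<open>f(m) - f(m')\<close>. The count
  k^2 is a crude bound for k(k-1)/2. An obstacle is \<open>trace_norm\<close>, which rests on a
  definite description of a square root. Squaring the deviation bound needs its nonnegativity, and
  this calls for existence and uniqueness of the root, hence for a spectral theorem; for measured
  operators, which are diagonal, the norm has to be evaluated explicitly.\<close>

lemma psd_herm: "psd I A \<Longrightarrow> a \<in> I \<Longrightarrow> b \<in> I \<Longrightarrow> A a b = cnj (A b a)"
  unfolding psd_def herm_def by blast

lemma psd_quad_nonneg: "psd I A \<Longrightarrow> 0 \<le> Re (\<Sum>a\<in>I. \<Sum>b\<in>I. cnj (v a) * A a b * v b)"
  unfolding psd_def by blast

text \<open>The form is linear in the coordinate at \<open>e\<close>, so a nonzero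
  \<open>A e b\<close> would let a large multiple of \<open>- A e b\<close> at that coordinate beat
  \<open>A b b\<close>. This covers the zero pivot in the Gram decomposition.\<close>

lemma psd_zero_diag:
  assumes I: "finite I" and A: "psd I A" and e: "e \<in> I" "A e e = 0" and b: "b \<in> I"
  shows "A e b = 0"
proof (rule ccontr)
  assume nz: "A e b \<noteq> 0"
  then have "e \<noteq> b" using e by auto
  \<comment> \<open>With this \<open>s\<close> the form at \<open>v\<close> equals
    \<open>- Re (A b b) - 2\<close>, against \<open>Re (A b b) \<ge> 0\<close>.\<close>
  define s where "s = (Re (A b b) + 1) / (cmod (A e b))\<^sup>2"
  define v where "v = (\<lambda>x. if x = e then - of_real s * A e b else if x = b then 1 else (0::complex))"
  have herm: "A b e = cnj (A e b)" using psd_herm[OF A b e(1)] .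
  have red: "(\<Sum>x\<in>I. g x) = g e + g b" if "\<And>x. x \<notin> {e, b} \<Longrightarrow> g x = 0" for g :: "_ \<Rightarrow> complex"
  proof -
    have "(\<Sum>x\<in>I. g x) = (\<Sum>x\<in>{e, b}. g x)"
      by (rule sum.mono_neutral_right) (use that I e b in auto)
    then show ?thesis using \<open>e \<noteq> b\<close> by simp
  qed
  have "(\<Sum>x\<in>I. \<Sum>y\<in>I. cnj (v x) * A x y * v y)
      = (\<Sum>x\<in>I. cnj (v x) * A x e * v e + cnj (v x) * A x b * v b)"
    by (intro sum.cong refl red) (auto simp: v_def)
  also have "\<dots> = (cnj (v e) * A e e * v e + cnj (v e) * A e b * v b)
      + (cnj (v b) * A b e * v e + cnj (v b) * A b b * v b)"
    by (intro red) (auto simp: v_def)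
  also have "\<dots> = - 2 * of_real s * (A e b * cnj (A e b)) + A b b"
    using \<open>e \<noteq> b\<close> herm e by (simp add: v_def algebra_simps)
  also have "\<dots> = - 2 * of_real s * of_real ((cmod (A e b))\<^sup>2) + A b b"
    by (simp only: complex_norm_square)
  also have "Re \<dots> = - 2 * s * (cmod (A e b))\<^sup>2 + Re (A b b)"
    by (simp only: of_real_mult[symmetric] plus_complex.sel) simp
  also have "\<dots> = - Re (A b b) - 2"
    using nz by (simp add: s_def)
  finally have 1: "Re (A b b) \<le> -2"
    using psd_quad_nonneg[OF A, of v] by simp
  define w where "w = (\<lambda>x. if x = b then 1 else (0::complex))"
  have "(\<Sum>x\<in>I. \<Sum>y\<in>I. cnj (w x) * A x y * w y) = A b b"
  proof -
    have "(\<Sum>x\<in>I. \<Sum>y\<in>I. cnj (w x) * A x y * w y) = (\<Sum>x\<in>I. cnj (w x) * A x b)"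
      using I b by (simp add: w_def if_distrib sum.delta cong: if_cong)
    also have "\<dots> = A b b"
      using I b by (simp add: w_def if_distrib[of cnj] if_distribR sum.delta cong: if_cong)
        (simp add: if_distrib[of "\<lambda>x. x * _"] cong: if_cong)
    finally show ?thesis .
  qed
  then have "0 \<le> Re (A b b)" using psd_quad_nonneg[OF A, of w] by simp
  with 1 show False by simp
qed

lemma psd_diag_nonneg:
  assumes I: "finite I" and A: "psd I A" and e: "e \<in> I"
  shows "0 \<le> Re (A e e)" "A e e = of_real (Re (A e e))"
proof -
  define w where "w = (\<lambda>x. if x = e then 1 else (0::complex))"
  have "(\<Sum>x\<in>I. \<Sum>y\<in>I. cnj (w x) * A x y * w y) = A e e"
  proof -
    have "(\<Sum>x\<in>I. \<Sum>y\<in>I. cnj (w x) * A x y * w y) = (\<Sum>x\<in>I. if x = e then A e e else 0)"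
      using I e by (intro sum.cong) (auto simp add: w_def if_distrib sum.delta cong: if_cong)
    then show ?thesis using I e by simp
  qed
  then show "0 \<le> Re (A e e)" using psd_quad_nonneg[OF A, of w] by simp
  have "A e e = cnj (A e e)" using psd_herm[OF A e e] .
  then show "A e e = of_real (Re (A e e))" by (simp add: complex_eq_iff)
qed

text \<open>Cholesky elimination: the pivot row and column are split off, and the Schur complement
  is positive again. The Gram vectors are indexed by \<open>I\<close> itself.\<close>

lemma psd_gram:
  assumes "finite I" "psd I A"
  shows "\<exists>w. \<forall>a\<in>I. \<forall>b\<in>I. A a b = (\<Sum>s\<in>I. w s a * cnj (w s b))"
  using assms
proof (induction I arbitrary: A rule: finite_induct)
  case empty
  then show ?case by simp
next
  case (insert e F)
  let ?I = "insert e F"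
  have fin: "finite ?I" using insert by simp
  define \<alpha> where "\<alpha> = Re (A e e)"
  have \<alpha>: "0 \<le> \<alpha>" "A e e = of_real \<alpha>"
    using psd_diag_nonneg[OF fin insert.prems, of e] by (auto simp: \<alpha>_def)
  have h: "A a b = cnj (A b a)" if "a \<in> ?I" "b \<in> ?I" for a b
    using psd_herm[OF insert.prems that] .
  \<comment> \<open>Schur complement of the pivot. For \<open>\<alpha> = 0\<close> division by zero
    gives 0, so \<open>B\<close> is then \<open>A\<close>, which fits because row and column
    \<open>e\<close> vanish.\<close>
  define B where "B = (\<lambda>a b. A a b - A a e * A e b / of_real \<alpha>)"
  have hB: "herm F B"
    unfolding herm_def B_def
  proof (intro ballI)
    fix a b assume "a \<in> F" "b \<in> F"
    then have "A a b = cnj (A b a)" "A a e = cnj (A e a)" "A b e = cnj (A e b)" using h by blast+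
    then show "A a b - A a e * A e b / of_real \<alpha> = cnj (A b a - A b e * A e a / of_real \<alpha>)"
      by (simp add: mult.commute)
  qed
  have qB: "0 \<le> Re (\<Sum>a\<in>F. \<Sum>b\<in>F. cnj (v a) * B a b * v b)" for v
  proof -
    define u where "u = (\<Sum>b\<in>F. A e b * v b)"
    have cu: "cnj u = (\<Sum>a\<in>F. cnj (v a) * A a e)"
      unfolding u_def cnj_sum
    proof (rule sum.cong[OF refl])
      fix a assume "a \<in> F"
      then have "A a e = cnj (A e a)" using h by blast
      then show "cnj (A e a * v a) = cnj (v a) * A a e" by simp
    qed
    \<comment> \<open>This coordinate at \<open>e\<close> minimises the form of \<open>A\<close>;
      completing the square leaves exactly the form of \<open>B\<close> at \<open>v\<close>.\<close>
    define v' where "v' = (\<lambda>x. if x = e then - u / of_real \<alpha> else v x)"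
    have vF: "(\<Sum>a\<in>F. g a (v' a)) = (\<Sum>a\<in>F. g a (v a))" for g :: "_ \<Rightarrow> _ \<Rightarrow> complex"
      by (rule sum.cong) (use insert.hyps in \<open>auto simp: v'_def\<close>)
    let ?q = "\<Sum>a\<in>F. \<Sum>b\<in>F. cnj (v a) * A a b * v b"
    have "(\<Sum>a\<in>?I. \<Sum>b\<in>?I. cnj (v' a) * A a b * v' b)
       = cnj (v' e) * A e e * v' e + (\<Sum>b\<in>F. cnj (v' e) * A e b * v' b)
        + (\<Sum>a\<in>F. cnj (v' a) * A a e * v' e + (\<Sum>b\<in>F. cnj (v' a) * A a b * v' b))"
      using insert.hyps by simp
    also have "\<dots> = cnj (v' e) * A e e * v' e + (\<Sum>b\<in>F. cnj (v' e) * A e b * v b)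
        + (\<Sum>a\<in>F. cnj (v a) * A a e * v' e + (\<Sum>b\<in>F. cnj (v a) * A a b * v b))"
      by (simp only: vF[of "\<lambda>b y. cnj (v' e) * A e b * y"] vF[of "\<lambda>b y. cnj _ * A _ b * y"]
          vF[of "\<lambda>a x. cnj x * A a e * v' e + (\<Sum>b\<in>F. cnj x * A a b * v b)"])
    also have "\<dots> = cnj (v' e) * A e e * v' e + cnj (v' e) * u + cnj u * v' e + ?q"
      unfolding cu unfolding u_def by (simp add: sum.distrib sum_distrib_left sum_distrib_right mult.assoc)
    also have "\<dots> = ?q - cnj u * u / of_real \<alpha>"
      by (cases "\<alpha> = 0") (auto simp: v'_def \<alpha> field_simps)
    also have "\<dots> = (\<Sum>a\<in>F. \<Sum>b\<in>F. cnj (v a) * B a b * v b)"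
      unfolding B_def cu unfolding u_def
      by (simp add: sum_product sum_divide_distrib sum_subtractf algebra_simps) (rule sum.swap)
    finally show ?thesis using psd_quad_nonneg[OF insert.prems, of v'] by simp
  qed
  obtain w where w: "\<And>a b. a \<in> F \<Longrightarrow> b \<in> F \<Longrightarrow> B a b = (\<Sum>s\<in>F. w s a * cnj (w s b))"
    using insert.IH[of B] hB qB unfolding psd_def by blast
  \<comment> \<open>Gram vector \<open>e\<close> is the pivot column divided by
    \<open>sqrt \<alpha>\<close>; it restores the rank-one term subtracted in
    \<open>B\<close>.\<close>
  define w' where "w' = (\<lambda>s a. if s = e then A a e / of_real (sqrt \<alpha>) else if a = e then 0 else w s a)"
  have sq: "complex_of_real (sqrt \<alpha>) * of_real (sqrt \<alpha>) = of_real \<alpha>"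
    using \<alpha> by (simp only: of_real_mult[symmetric] real_sqrt_mult_self) simp
  have zero: "A e a = 0" "A a e = 0" if "\<alpha> = 0" "a \<in> ?I" for a
  proof -
    show "A e a = 0"
      using psd_zero_diag[OF fin insert.prems, of e a] that \<alpha> by simp
    then show "A a e = 0" using h[OF that(2), of e] by simp
  qed
  have "A a b = (\<Sum>s\<in>?I. w' s a * cnj (w' s b))" if ab: "a \<in> ?I" "b \<in> ?I" for a b
  proof -
    have F: "(\<Sum>s\<in>F. w' s a * cnj (w' s b)) = (if a = e \<or> b = e then 0 else B a b)"
    proof (cases "a = e \<or> b = e")
      case True
      then show ?thesis using insert.hyps by (auto simp: w'_def intro!: sum.neutral)
    next
      case False
      then have "a \<in> F" "b \<in> F" using ab by auto
      then show ?thesis using False insert.hyps by (auto simp: w w'_def intro!: sum.cong)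
    qed
    have "w' e a * cnj (w' e b) = A a e * A e b / of_real \<alpha>"
    proof -
      have "A e b = cnj (A b e)" using h ab by blast
      then show ?thesis using sq by (simp add: w'_def)
    qed
    then show ?thesis
      using insert.hyps F zero ab by (cases "\<alpha> = 0") (auto simp: B_def \<alpha>)
  qed
  then show ?case by blast
qed

lemma gram_mult_vec:
  assumes w: "\<And>a b. a \<in> I \<Longrightarrow> b \<in> I \<Longrightarrow> A a b = (\<Sum>s\<in>I. w s a * cnj (w s b))" and a: "a \<in> I"
  shows "(\<Sum>b\<in>I. A a b * v b) = (\<Sum>s\<in>I. w s a * (\<Sum>b\<in>I. cnj (w s b) * v b))"
proof -
  have "(\<Sum>b\<in>I. A a b * v b) = (\<Sum>b\<in>I. \<Sum>s\<in>I. w s a * (cnj (w s b) * v b))"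
    using w a by (intro sum.cong refl) (simp add: sum_distrib_right mult.assoc)
  also have "\<dots> = (\<Sum>s\<in>I. w s a * (\<Sum>b\<in>I. cnj (w s b) * v b))"
    unfolding sum_distrib_left by (rule sum.swap)
  finally show ?thesis .
qed

lemma gram_quad:
  assumes w: "\<And>a b. a \<in> I \<Longrightarrow> b \<in> I \<Longrightarrow> A a b = (\<Sum>s\<in>I. w s a * cnj (w s b))"
  shows "Re (\<Sum>a\<in>I. \<Sum>b\<in>I. cnj (v a) * A a b * v b) = (\<Sum>s\<in>I. (cmod (\<Sum>b\<in>I. cnj (w s b) * v b))\<^sup>2)"
proof -
  define u where "u = (\<lambda>s. \<Sum>b\<in>I. cnj (w s b) * v b)"
  have cu: "cnj (u s) = (\<Sum>a\<in>I. cnj (v a) * w s a)" for s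
    by (simp add: u_def mult.commute)
  have "(\<Sum>a\<in>I. \<Sum>b\<in>I. cnj (v a) * A a b * v b) = (\<Sum>a\<in>I. cnj (v a) * (\<Sum>b\<in>I. A a b * v b))"
    by (simp add: sum_distrib_left mult.assoc)
  also have "\<dots> = (\<Sum>a\<in>I. \<Sum>s\<in>I. cnj (v a) * w s a * u s)"
    using gram_mult_vec[of I A w, OF w] by (intro sum.cong refl) (simp add: u_def sum_distrib_left mult.assoc)
  also have "\<dots> = (\<Sum>s\<in>I. \<Sum>a\<in>I. cnj (v a) * w s a * u s)" by (rule sum.swap)
  also have "\<dots> = (\<Sum>s\<in>I. cnj (u s) * u s)"
    by (simp add: cu sum_distrib_right)
  also have "\<dots> = of_real (\<Sum>s\<in>I. (cmod (u s))\<^sup>2)"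
    by (simp only: of_real_sum complex_norm_square mult.commute)
  finally show ?thesis by (simp only: Re_complex_of_real u_def)
qed

lemma quad_scalar_minus:
  assumes I: "finite I"
  shows "Re (\<Sum>a\<in>I. \<Sum>b\<in>I. cnj (v a) * ((if a = b then of_real t else 0) - A a b) * v b)
    = t * (\<Sum>a\<in>I. (cmod (v a))\<^sup>2) - Re (\<Sum>a\<in>I. \<Sum>b\<in>I. cnj (v a) * A a b * v b)"
proof -
  have "(\<Sum>a\<in>I. \<Sum>b\<in>I. cnj (v a) * (if a = b then of_real t else 0) * v b)
      = (\<Sum>a\<in>I. \<Sum>b\<in>I. if b = a then of_real t * (v a * cnj (v a)) else 0)"
    by (intro sum.cong refl) auto
  also have "\<dots> = (\<Sum>a\<in>I. of_real (t * (cmod (v a))\<^sup>2))"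
    using I by (simp add: complex_norm_square del: of_real_power)
  also have "\<dots> = of_real (t * (\<Sum>a\<in>I. (cmod (v a))\<^sup>2))"
    by (simp only: of_real_sum sum_distrib_left)
  finally have "Re (\<Sum>a\<in>I. \<Sum>b\<in>I. cnj (v a) * (if a = b then of_real t else 0) * v b)
      = t * (\<Sum>a\<in>I. (cmod (v a))\<^sup>2)" by (simp only: Re_complex_of_real)
  then show ?thesis by (simp add: right_diff_distrib left_diff_distrib sum_subtractf)
qed

lemma herm_scalar_minus:
  assumes "herm I A"
  shows "herm I (\<lambda>a b. (if a = b then complex_of_real t else 0) - A a b)"
  unfolding herm_def
proof (intro ballI)
  fix a b assume "a \<in> I" "b \<in> I"
  then have "cnj (A b a) = A a b" using assms unfolding herm_def by metis
  then show "(if a = b then complex_of_real t else 0) - A a b = cnj ((if b = a then of_real t else 0) - A b a)"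
    by simp
qed

text \<open>Any positive square root commutes with a nonnegative diagonal matrix of the same square,
  which pins it down.\<close>
lemma psd_sqrt_diag_unique:
  assumes I: "finite I" and B: "psd I B" and r: "\<And>a. a \<in> I \<Longrightarrow> 0 \<le> r a"
    and sq: "\<And>a b. a \<in> I \<Longrightarrow> b \<in> I \<Longrightarrow> mmul I B B a b = (if a = b then of_real ((r a)\<^sup>2) else 0)"
    and a: "a \<in> I" and c: "c \<in> I"
  shows "B a c = (if a = c then of_real (r a) else 0)"
proof -
  define D where "D = (\<lambda>a b. if a = b then complex_of_real (r a) else 0)"
  have h: "B x y = cnj (B y x)" if "x \<in> I" "y \<in> I" for x y
    using psd_herm[OF B that] .
  have zero: "B x y = 0" if x: "x \<in> I" and y: "y \<in> I" and rx: "r x = 0" for x y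
  proof -
    have "mmul I B B x x = (\<Sum>z\<in>I. of_real ((cmod (B x z))\<^sup>2))"
      unfolding mmul_def
    proof (rule sum.cong[OF refl])
      fix z assume "z \<in> I"
      then have "B z x = cnj (B x z)" using h x by blast
      then show "B x z * B z x = of_real ((cmod (B x z))\<^sup>2)" by (simp only: complex_norm_square)
    qed
    with sq[OF x x] rx have "of_real (\<Sum>z\<in>I. (cmod (B x z))\<^sup>2) = (0::complex)" by simp
    then have "(\<Sum>z\<in>I. (cmod (B x z))\<^sup>2) = 0" by (simp only: of_real_eq_0_iff)
    then show ?thesis using I y by (simp add: sum_nonneg_eq_0_iff)
  qed
  have comm: "B x y * of_real (r y) = of_real (r x) * B x y" if x: "x \<in> I" and y: "y \<in> I" for x y
  proof -
    have "(\<Sum>z\<in>I. B x z * mmul I B B z y) = (\<Sum>z\<in>I. mmul I B B x z * B z y)"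
      unfolding mmul_def sum_distrib_left sum_distrib_right
      by (subst sum.swap) (simp add: mult.assoc)
    also have "(\<Sum>z\<in>I. B x z * mmul I B B z y) = (\<Sum>z\<in>I. if z = y then B x y * of_real ((r y)\<^sup>2) else 0)"
      using sq y by (intro sum.cong) auto
    also have "(\<Sum>z\<in>I. mmul I B B x z * B z y) = (\<Sum>z\<in>I. if z = x then of_real ((r x)\<^sup>2) * B x y else 0)"
      using sq x by (intro sum.cong) auto
    finally have "B x y * of_real ((r y)\<^sup>2) = of_real ((r x)\<^sup>2) * B x y" using I x y by simp
    then have "B x y = 0 \<or> complex_of_real ((r y)\<^sup>2) = of_real ((r x)\<^sup>2)" by (auto simp: mult.commute)
    then have "B x y = 0 \<or> (r y)\<^sup>2 = (r x)\<^sup>2" by (simp only: of_real_eq_iff)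
    then show ?thesis using r x y by (auto simp: power2_eq_iff_nonneg)
  qed
  show ?thesis
  proof (cases "r a = 0")
    case True
    then show ?thesis using zero a c by auto
  next
    case False
    \<comment> \<open>\<open>v\<close> is column \<open>c\<close> of \<open>B - D\<close>. As
      \<open>B\<close> and \<open>D\<close> commute and have equal squares,
      \<open>(B + D) (B - D) = 0\<close>, so the forms of \<open>B\<close> and \<open>D\<close> at
      \<open>v\<close> add up to 0. Both are nonnegative, hence \<open>v\<close> vanishes where
      \<open>r\<close> does not.\<close>
    define v where "v = (\<lambda>x. B x c - D x c)"
    have BDv: "(\<Sum>y\<in>I. B x y * v y) + of_real (r x) * v x = 0" if x: "x \<in> I" for x
    proof -
      have "(\<Sum>y\<in>I. B x y * v y) = mmul I B B x c - (\<Sum>y\<in>I. if y = c then B x c * of_real (r c) else 0)"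
        unfolding v_def mmul_def D_def
        by (simp only: right_diff_distrib sum_subtractf) (intro arg_cong2[of _ _ _ _ minus] sum.cong refl, auto)
      also have "\<dots> = mmul I B B x c - of_real (r x) * B x c"
        using I c x comm by simp
      finally show ?thesis using sq[OF x c]
        by (simp add: v_def D_def algebra_simps power2_eq_square)
    qed
    have "(\<Sum>x\<in>I. cnj (v x) * ((\<Sum>y\<in>I. B x y * v y) + of_real (r x) * v x)) = 0"
      using BDv by simp
    then have "Re (\<Sum>x\<in>I. cnj (v x) * ((\<Sum>y\<in>I. B x y * v y) + of_real (r x) * v x)) = 0" by simp
    moreover have "(\<Sum>x\<in>I. cnj (v x) * ((\<Sum>y\<in>I. B x y * v y) + of_real (r x) * v x))
       = (\<Sum>x\<in>I. \<Sum>y\<in>I. cnj (v x) * B x y * v y) + (\<Sum>x\<in>I. of_real (r x * (cmod (v x))\<^sup>2))"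
      by (simp add: distrib_left sum.distrib sum_distrib_left mult.assoc)
         (simp add: mult.left_commute mult.commute complex_norm_square flip: of_real_power)
    moreover have "0 \<le> Re (\<Sum>x\<in>I. \<Sum>y\<in>I. cnj (v x) * B x y * v y)"
      using psd_quad_nonneg[OF B] .
    ultimately have "(\<Sum>x\<in>I. r x * (cmod (v x))\<^sup>2) \<le> 0" by simp
    moreover have nn: "0 \<le> r x * (cmod (v x))\<^sup>2" if "x \<in> I" for x using r that by simp
    ultimately have "(\<Sum>x\<in>I. r x * (cmod (v x))\<^sup>2) = 0"
      using sum_nonneg[of I "\<lambda>x. r x * (cmod (v x))\<^sup>2"] by fastforce
    then have "r a * (cmod (v a))\<^sup>2 = 0" using nn I a by (subst (asm) sum_nonneg_eq_0_iff) auto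
    then show ?thesis using False by (simp add: v_def D_def)
  qed
qed

lemma psd_diag:
  assumes I: "finite I" and r: "\<And>a. a \<in> I \<Longrightarrow> 0 \<le> r a"
  shows "psd I (\<lambda>a b. if a = b \<and> a \<in> I then of_real (r a) else 0)"
proof -
  have "(\<Sum>a\<in>I. \<Sum>b\<in>I. cnj (v a) * (if a = b \<and> a \<in> I then of_real (r a) else 0) * v b)
     = (\<Sum>a\<in>I. of_real (r a * (cmod (v a))\<^sup>2))" for v
  proof (rule sum.cong[OF refl])
    fix a assume a: "a \<in> I"
    have "(\<Sum>b\<in>I. cnj (v a) * (if a = b \<and> a \<in> I then of_real (r a) else 0) * v b)
       = (\<Sum>b\<in>I. if b = a then cnj (v a) * of_real (r a) * v a else 0)"
      using a by (intro sum.cong) auto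
    also have "\<dots> = of_real (r a * (cmod (v a))\<^sup>2)"
      using I a complex_norm_square[of "v a"] by (simp add: mult_ac)
    finally show "(\<Sum>b\<in>I. cnj (v a) * (if a = b \<and> a \<in> I then of_real (r a) else 0) * v b)
       = of_real (r a * (cmod (v a))\<^sup>2)" .
  qed
  moreover have "0 \<le> Re (\<Sum>a\<in>I. of_real (r a * (cmod (v a))\<^sup>2))" for v
    using r by (simp add: sum_nonneg)
  ultimately show ?thesis unfolding psd_def herm_def by auto
qed

text \<open>The diagonal matrix of absolute values is a positive root of \<open>adj A\<close> times
  \<open>A\<close>, and \<open>psd_sqrt_diag_unique\<close> makes it the one that
  \<open>opsqrt\<close> describes. This turns the trace norm of a measured operator into an l1
  norm.\<close>

lemma trace_norm_diag:
  assumes I: "finite I" and off: "\<And>a b. a \<in> I \<Longrightarrow> b \<in> I \<Longrightarrow> a \<noteq> b \<Longrightarrow> A a b = 0"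
  shows "trace_norm I A = (\<Sum>a\<in>I. cmod (A a a))"
proof -
  define S where "S = (\<lambda>a b. if a = b \<and> a \<in> I then complex_of_real (cmod (A a a)) else 0)"
  have sq: "mmul I (adj A) A a b = (if a = b then of_real ((cmod (A a a))\<^sup>2) else 0)"
    if a: "a \<in> I" and b: "b \<in> I" for a b
  proof -
    have "mmul I (adj A) A a b = (\<Sum>z\<in>I. if z = a then (if a = b then cnj (A a a) * A a a else 0) else 0)"
      unfolding mmul_def adj_def using off a b by (intro sum.cong) auto
    then show ?thesis using I a by (simp add: complex_norm_square mult.commute del: of_real_power)
  qed
  have SS: "mmul I S S a b = (if a = b then of_real ((cmod (A a a))\<^sup>2) else 0)"
    if a: "a \<in> I" and b: "b \<in> I" for a b
  proof -
    have "mmul I S S a b = (\<Sum>z\<in>I. if z = a then (if a = b then of_real ((cmod (A a a))\<^sup>2) else 0) else 0)"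
      unfolding mmul_def S_def using a b by (intro sum.cong) (auto simp: power2_eq_square)
    then show ?thesis using I a by simp
  qed
  have "opsqrt I (mmul I (adj A) A) = S"
    unfolding opsqrt_def
  proof (rule the_equality)
    show "psd I S \<and> (\<forall>a b. a \<notin> I \<or> b \<notin> I \<longrightarrow> S a b = 0) \<and>
        (\<forall>a\<in>I. \<forall>b\<in>I. mmul I S S a b = mmul I (adj A) A a b)"
      using psd_diag[OF I, of "\<lambda>a. cmod (A a a)"] by (auto simp: SS sq) (auto simp: S_def)
  next
    fix B assume B: "psd I B \<and> (\<forall>a b. a \<notin> I \<or> b \<notin> I \<longrightarrow> B a b = 0) \<and>
        (\<forall>a\<in>I. \<forall>b\<in>I. mmul I B B a b = mmul I (adj A) A a b)"
    show "B = S"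
    proof (intro ext)
      fix a b
      show "B a b = S a b"
      proof (cases "a \<in> I \<and> b \<in> I")
        case True
        then show ?thesis
          using psd_sqrt_diag_unique[OF I, of B "\<lambda>a. cmod (A a a)" a b] B sq by (auto simp: S_def)
      next
        case False
        then show ?thesis using B by (auto simp: S_def)
      qed
    qed
  qed
  then show ?thesis unfolding trace_norm_def trace_def by (simp add: S_def)
qed

subsection \<open>Spectral theorem and positive square roots\<close>

text \<open>Bolzano-Weierstrass for one coordinate at a time, along the subsequence already chosen.
  It supplies the maximiser of the Rayleigh quotient.\<close>

lemma convergent_subseq_pointwise:
  fixes v :: "nat \<Rightarrow> 'i \<Rightarrow> complex"
  assumes "finite I" "\<And>n a. a \<in> I \<Longrightarrow> cmod (v n a) \<le> 1"
  shows "\<exists>r l. strict_mono (r :: nat \<Rightarrow> nat) \<and> (\<forall>a\<in>I. (\<lambda>n. v (r n) a) \<longlonglongrightarrow> l a)"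
  using assms
proof (induction I rule: finite_induct)
  case empty
  show ?case by (intro exI[of _ id]) (auto simp: strict_mono_def)
next
  case (insert e F)
  obtain r l where r: "strict_mono (r :: nat \<Rightarrow> nat)" and l: "\<And>a. a \<in> F \<Longrightarrow> (\<lambda>n. v (r n) a) \<longlonglongrightarrow> l a"
    using insert.IH insert.prems by (metis insertCI)
  have "bounded (range (\<lambda>n. v (r n) e))"
    using insert.prems by (auto simp: bounded_iff)
  then obtain le s where s: "strict_mono (s :: nat \<Rightarrow> nat)" and le: "((\<lambda>n. v (r n) e) \<circ> s) \<longlonglongrightarrow> le"
    using bounded_imp_convergent_subsequence by blast
  have "(\<lambda>n. v ((r \<circ> s) n) a) \<longlonglongrightarrow> (if a = e then le else l a)" if "a \<in> insert e F" for a
    using that le LIMSEQ_subseq_LIMSEQ[OF l s] by (auto simp: o_def)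
  then show ?case using strict_mono_o[OF r s]
    by (intro exI[of _ "r \<circ> s"] exI[of _ "\<lambda>a. if a = e then le else l a"] conjI ballI)
qed

text \<open>The form is a sum of squared moduli of Gram products; if it vanishes, so does each
  product, and these products determine the image of \<open>v\<close> under
  \<open>A\<close>.\<close>

lemma psd_quad_eq_0:
  assumes I: "finite I" and A: "psd I A" and z: "Re (\<Sum>a\<in>I. \<Sum>b\<in>I. cnj (v a) * A a b * v b) = 0"
    and a: "a \<in> I"
  shows "(\<Sum>b\<in>I. A a b * v b) = 0"
proof -
  obtain w where w: "\<And>a b. a \<in> I \<Longrightarrow> b \<in> I \<Longrightarrow> A a b = (\<Sum>s\<in>I. w s a * cnj (w s b))"
    using psd_gram[OF I A] by blast
  have "(\<Sum>s\<in>I. (cmod (\<Sum>b\<in>I. cnj (w s b) * v b))\<^sup>2) = 0"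
    using gram_quad[of I A w, OF w] z by simp
  then have "(\<Sum>b\<in>I. cnj (w s b) * v b) = 0" if "s \<in> I" for s
    using I that by (simp add: sum_nonneg_eq_0_iff)
  then show ?thesis using gram_mult_vec[of I A w, OF w a] by simp
qed

text \<open>A maximiser of the Rayleigh quotient is an eigenvector.\<close>
lemma herm_eigenvector:
  assumes I: "finite I" "I \<noteq> {}" and A: "herm I A"
  shows "\<exists>\<mu> v. (\<Sum>a\<in>I. (cmod (v a))\<^sup>2) = 1 \<and> (\<forall>a. a \<notin> I \<longrightarrow> v a = 0) \<and>
    (\<forall>a\<in>I. (\<Sum>b\<in>I. A a b * v b) = complex_of_real \<mu> * v a)"
proof -
  define q where "q = (\<lambda>v. Re (\<Sum>a\<in>I. \<Sum>b\<in>I. cnj (v a) * A a b * v b))"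
  define S where "S = {v :: 'a \<Rightarrow> complex. (\<Sum>a\<in>I. (cmod (v a))\<^sup>2) = 1}"
  have le1: "cmod (v a) \<le> 1" if "v \<in> S" "a \<in> I" for v a
  proof -
    have "(cmod (v a))\<^sup>2 \<le> (\<Sum>a\<in>I. (cmod (v a))\<^sup>2)" using that I by (intro member_le_sum) auto
    then have "(cmod (v a))\<^sup>2 \<le> 1\<^sup>2" using that by (simp add: S_def)
    then show ?thesis by (rule power2_le_imp_le) simp
  qed
  have bd: "q v \<le> (\<Sum>a\<in>I. \<Sum>b\<in>I. cmod (A a b))" if v: "v \<in> S" for v
  proof -
    have "cmod (cnj (v a) * A a b * v b) \<le> cmod (A a b)" if "a \<in> I" "b \<in> I" for a b
    proof -
      have "cmod (cnj (v a) * A a b * v b) = cmod (v a) * cmod (v b) * cmod (A a b)"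
        by (simp add: norm_mult)
      also have "\<dots> \<le> 1 * 1 * cmod (A a b)" using le1 v that by (intro mult_mono) auto
      finally show ?thesis by simp
    qed
    then have "cmod (\<Sum>a\<in>I. \<Sum>b\<in>I. cnj (v a) * A a b * v b) \<le> (\<Sum>a\<in>I. \<Sum>b\<in>I. cmod (A a b))"
      by (intro sum_norm_le) auto
    then show ?thesis unfolding q_def using complex_Re_le_cmod order_trans by blast
  qed
  obtain e where e: "e \<in> I" using I by blast
  have "(\<Sum>a\<in>I. (cmod (if a = e then 1 else 0))\<^sup>2) = (\<Sum>a\<in>I. if a = e then 1 else 0)"
    by (intro sum.cong) auto
  then have "(\<lambda>a. if a = e then 1 else 0) \<in> S" using I e by (simp add: S_def)
  then have ne: "q ` S \<noteq> {}" by blast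
  have bdd: "bdd_above (q ` S)" using bd by (auto simp: bdd_above_def)
  define \<mu> where "\<mu> = Sup (q ` S)"
  have le: "q v \<le> \<mu>" if "v \<in> S" for v
    unfolding \<mu>_def using that bdd by (intro cSup_upper) auto
  have "\<exists>v\<in>S. \<mu> - 1 / real (Suc n) < q v" for n
    using less_cSup_iff[OF ne bdd, of "\<mu> - 1 / real (Suc n)"] unfolding \<mu>_def[symmetric] by auto
  then obtain v where vS: "\<And>n. v n \<in> S" and vq: "\<And>n. \<mu> - 1 / real (Suc n) < q (v n)"
    by metis
  obtain r l where r: "strict_mono (r :: nat \<Rightarrow> nat)" and l: "\<And>a. a \<in> I \<Longrightarrow> (\<lambda>n. v (r n) a) \<longlonglongrightarrow> l a"
    using convergent_subseq_pointwise[OF I(1), of v] le1[OF vS] by blast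
  have "(\<lambda>n. \<Sum>a\<in>I. (cmod (v (r n) a))\<^sup>2) \<longlonglongrightarrow> (\<Sum>a\<in>I. (cmod (l a))\<^sup>2)"
    by (intro tendsto_intros l)
  moreover have "(\<lambda>n. \<Sum>a\<in>I. (cmod (v (r n) a))\<^sup>2) = (\<lambda>n. 1)"
    using vS by (auto simp: S_def)
  ultimately have lS: "(\<Sum>a\<in>I. (cmod (l a))\<^sup>2) = 1" by (simp add: LIMSEQ_const_iff)
  have ql: "(\<lambda>n. q (v (r n))) \<longlonglongrightarrow> q l"
    unfolding q_def by (intro tendsto_intros l)
  have "(\<lambda>n. \<mu> - 1 / real (Suc (r n))) \<longlonglongrightarrow> \<mu> - 0"
    by (intro tendsto_diff tendsto_const LIMSEQ_subseq_LIMSEQ[OF LIMSEQ_inverse_real_of_nat[unfolded inverse_eq_divide] r, unfolded o_def])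
  then have "\<mu> - 0 \<le> q l"
    by (rule LIMSEQ_le[OF _ ql]) (use vq in \<open>auto intro: less_imp_le\<close>)
  then have q\<mu>: "q l = \<mu>" using le[of l] lS by (simp add: S_def)
  \<comment> \<open>As \<open>\<mu>\<close> is the supremum of the form on the unit sphere,
    \<open>\<mu> I - A\<close> is positive; its form vanishes at the maximiser \<open>l\<close>, so
    \<open>l\<close> lies in its kernel.\<close>
  define R where "R = (\<lambda>a b. (if a = b then of_real \<mu> else 0) - A a b)"
  have qR: "Re (\<Sum>a\<in>I. \<Sum>b\<in>I. cnj (w a) * R a b * w b) = \<mu> * (\<Sum>a\<in>I. (cmod (w a))\<^sup>2) - q w" for w
    unfolding R_def q_def by (rule quad_scalar_minus[OF I(1)])
  have "psd I R"
    unfolding psd_def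
  proof (intro conjI allI)
    show "herm I R" unfolding R_def by (rule herm_scalar_minus[OF A])
    fix w
    define T where "T = (\<Sum>a\<in>I. (cmod (w a))\<^sup>2)"
    show "0 \<le> Re (\<Sum>a\<in>I. \<Sum>b\<in>I. cnj (w a) * R a b * w b)"
    proof (cases "T = 0")
      case True
      then have "w a = 0" if "a \<in> I" for a
        using I that by (simp add: T_def sum_nonneg_eq_0_iff)
      then show ?thesis by simp
    next
      case False
      then have T: "0 < T" unfolding T_def by (metis less_eq_real_def sum_nonneg zero_le_power2)
      define w' where "w' = (\<lambda>a. w a / of_real (sqrt T))"
      have "(\<Sum>a\<in>I. (cmod (w' a))\<^sup>2) = T / T"
        using T unfolding w'_def T_def[symmetric]
        by (simp add: norm_divide power_divide T_def flip: sum_divide_distrib)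
      then have "q w' \<le> \<mu>" using T by (intro le) (simp add: S_def)
      moreover have "q w' = q w / T"
      proof -
        have "cnj (w' a) * A a b * w' b = cnj (w a) * A a b * w b / of_real T" for a b
        proof -
          have "cnj (w' a) * A a b * w' b = cnj (w a) * A a b * w b / (of_real (sqrt T) * of_real (sqrt T))"
            by (simp add: w'_def)
          also have "complex_of_real (sqrt T) * of_real (sqrt T) = of_real T"
            using T by (simp only: of_real_mult[symmetric] real_sqrt_mult_self) simp
          finally show ?thesis .
        qed
        then have "(\<Sum>a\<in>I. \<Sum>b\<in>I. cnj (w' a) * A a b * w' b) = (\<Sum>a\<in>I. \<Sum>b\<in>I. cnj (w a) * A a b * w b) / of_real T"
          by (simp only: sum_divide_distrib)
        then show ?thesis by (simp only: q_def Re_divide_of_real)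
      qed
      ultimately show ?thesis using T unfolding qR T_def[symmetric] by (simp add: field_simps)
    qed
  qed
  moreover have "Re (\<Sum>a\<in>I. \<Sum>b\<in>I. cnj (l a) * R a b * l b) = 0"
    unfolding qR by (simp add: lS q\<mu>)
  ultimately have R0: "(\<Sum>b\<in>I. R a b * l b) = 0" if "a \<in> I" for a
    using psd_quad_eq_0[OF I(1)] that by blast
  have ev: "(\<Sum>b\<in>I. A a b * l b) = of_real \<mu> * l a" if a: "a \<in> I" for a
  proof -
    have "(\<Sum>b\<in>I. R a b * l b) = (\<Sum>b\<in>I. if b = a then of_real \<mu> * l a else 0) - (\<Sum>b\<in>I. A a b * l b)"
      unfolding R_def left_diff_distrib sum_subtractf
      by (intro arg_cong2[of _ _ _ _ minus] sum.cong refl) auto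
    then show ?thesis using R0[OF a] I a by simp
  qed
  \<comment> \<open>Vanishing outside \<open>I\<close> keeps the reflection built from this vector
    supported in \<open>I\<close>.\<close>
  define l' where "l' = (\<lambda>a. if a \<in> I then l a else 0)"
  show ?thesis
    by (rule exI[of _ \<mu>], rule exI[of _ l']) (use lS ev in \<open>auto simp: l'_def cong: sum.cong\<close>)
qed

text \<open>Entries outside \<open>I\<close> carry no meaning. Fixing them to 0 turns identities of
  operators into equalities of functions and matches the normalisation inside
  \<open>opsqrt\<close>.\<close>

definition supp :: "'i set \<Rightarrow> ('i \<Rightarrow> 'i \<Rightarrow> complex) \<Rightarrow> bool" where
  "supp I A \<longleftrightarrow> (\<forall>a b. a \<notin> I \<or> b \<notin> I \<longrightarrow> A a b = 0)"

definition idm :: "'i set \<Rightarrow> 'i \<Rightarrow> 'i \<Rightarrow> complex" where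
  "idm I a b = (if a = b \<and> a \<in> I then 1 else 0)"

lemma mmul_assoc: "mmul I (mmul I A B) C = mmul I A (mmul I B C)"
  unfolding mmul_def sum_distrib_left sum_distrib_right
  by (intro ext, subst sum.swap) (simp add: mult.assoc)

lemma adj_mmul: "adj (mmul I A B) = mmul I (adj B) (adj A)"
  by (simp add: mmul_def adj_def mult.commute)

lemma adj_adj [simp]: "adj (adj A) = A"
  by (simp add: adj_def)

lemma supp_mmul: "supp I A \<Longrightarrow> supp I B \<Longrightarrow> supp I (mmul I A B)"
  by (auto simp: supp_def mmul_def)

lemma supp_adj: "supp I A \<Longrightarrow> supp I (adj A)"
  by (auto simp: supp_def adj_def)

lemma supp_idm: "supp I (idm I)"
  by (auto simp: supp_def idm_def)

lemma mmul_idm_left: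
  assumes "finite I" "supp I A"
  shows "mmul I (idm I) A = A"
proof (intro ext)
  fix a b
  have "mmul I (idm I) A a b = (\<Sum>x\<in>I. if x = a then A a b else 0)"
    unfolding mmul_def idm_def by (intro sum.cong) auto
  then show "mmul I (idm I) A a b = A a b" using assms by (auto simp: supp_def)
qed

lemma mmul_idm_right:
  assumes "finite I" "supp I A"
  shows "mmul I A (idm I) = A"
proof (intro ext)
  fix a b
  have "mmul I A (idm I) a b = (\<Sum>x\<in>I. if x = b then A a b else 0)"
    unfolding mmul_def idm_def by (intro sum.cong) auto
  then show "mmul I A (idm I) a b = A a b" using assms by (auto simp: supp_def)
qed

lemma herm_iff_adj: "supp I A \<Longrightarrow> herm I A \<longleftrightarrow> adj A = A"
  unfolding herm_def adj_def supp_def fun_eq_iff by (metis complex_cnj_zero)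

text \<open>The reflection \<open>H = I - 2 u u^* / |u|^2\<close> with
  \<open>u = e - \<gamma> v\<close> maps the basis vector \<open>e\<close> to
  \<open>\<gamma> v\<close>. Being hermitian and an involution, it is a unitary change of basis
  between an eigenvector and a coordinate axis.\<close>

lemma householder:
  assumes I: "finite I" and e: "e \<in> I" and v1: "(\<Sum>a\<in>I. (cmod (v a))\<^sup>2) = 1"
    and v0: "\<And>a. a \<notin> I \<Longrightarrow> v a = 0"
  shows "\<exists>H \<gamma>. supp I H \<and> adj H = H \<and> mmul I H H = idm I \<and> (\<forall>a. H a e = \<gamma> * v a)"
proof -
  \<comment> \<open>The phase makes \<open>\<gamma> * v e\<close> equal to
    \<open>- cmod (v e)\<close>, so \<open>u e = 1 + cmod (v e)\<close> is real and at least 1;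
    nothing cancels, and the squared norm of \<open>u\<close> is \<open>2 * s\<close>.\<close>
  define \<gamma> where "\<gamma> = (if v e = 0 then 1 else - cnj (v e) / of_real (cmod (v e)))"
  have g1: "cmod \<gamma> = 1" by (simp add: \<gamma>_def norm_divide)
  have ge: "\<gamma> * v e = - of_real (cmod (v e))"
  proof (cases "v e = 0")
    case False
    then show ?thesis
      using complex_norm_square[of "v e"]
      by (simp add: \<gamma>_def field_simps power2_eq_square)
  qed simp
  define s where "s = 1 + cmod (v e)"
  have s: "0 < s" by (simp add: s_def add_pos_nonneg)
  define u where "u = (\<lambda>a. idm I a e - \<gamma> * v a)"
  have ue: "u e = of_real s" using e ge by (simp add: u_def idm_def s_def)
  have "(\<Sum>a\<in>I. (cmod (u a))\<^sup>2) = (cmod (u e))\<^sup>2 + (\<Sum>a\<in>I - {e}. (cmod (u a))\<^sup>2)"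
    using I e by (rule sum.remove)
  also have "(\<Sum>a\<in>I - {e}. (cmod (u a))\<^sup>2) = (\<Sum>a\<in>I - {e}. (cmod (v a))\<^sup>2)"
    using g1 by (intro sum.cong) (auto simp: u_def idm_def norm_mult)
  also have "\<dots> = 1 - (cmod (v e))\<^sup>2"
    using sum.remove[OF I e, of "\<lambda>a. (cmod (v a))\<^sup>2"] v1 by simp
  also have "(cmod (u e))\<^sup>2 + (1 - (cmod (v e))\<^sup>2) = 2 * s"
  proof -
    have "cmod (u e) = s" unfolding ue norm_of_real using s by simp
    then show ?thesis by (simp add: s_def power2_eq_square algebra_simps)
  qed
  finally have nu: "(\<Sum>a\<in>I. (cmod (u a))\<^sup>2) = 2 * s" .
  have uu: "(\<Sum>x\<in>I. cnj (u x) * u x) = 2 * of_real s"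
  proof -
    have "(\<Sum>x\<in>I. cnj (u x) * u x) = of_real (\<Sum>a\<in>I. (cmod (u a))\<^sup>2)"
      by (simp only: of_real_sum complex_norm_square mult.commute)
    then show ?thesis by (simp add: nu)
  qed
  define K where "K = (\<lambda>a b. u a * cnj (u b) / of_real s)"
  define H where "H = (\<lambda>a b. idm I a b - K a b)"
  have sK: "supp I K" using v0 by (auto simp: K_def supp_def u_def idm_def)
  have sH: "supp I H" using sK by (auto simp: H_def supp_def idm_def)
  have KK: "mmul I K K a b = 2 * K a b" for a b
  proof -
    have "mmul I K K a b = (\<Sum>x\<in>I. cnj (u x) * u x) * (u a * cnj (u b) / (of_real s)\<^sup>2)"
      unfolding mmul_def K_def sum_distrib_right by (simp add: power2_eq_square mult_ac)
    then show ?thesis using s by (simp add: uu K_def power2_eq_square)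
  qed
  have "mmul I H H a b = idm I a b" for a b
  proof -
    have "mmul I H H a b = mmul I (idm I) (idm I) a b - mmul I (idm I) K a b - mmul I K (idm I) a b + mmul I K K a b"
      by (simp add: mmul_def H_def algebra_simps sum.distrib sum_subtractf)
    also have "\<dots> = idm I a b"
      unfolding KK mmul_idm_left[OF I supp_idm] mmul_idm_left[OF I sK] mmul_idm_right[OF I sK] by simp
    finally show ?thesis .
  qed
  moreover have "adj H = H" by (auto simp: adj_def H_def K_def idm_def fun_eq_iff)
  moreover have "H a e = \<gamma> * v a" for a
    using s by (simp add: H_def K_def ue) (simp add: u_def)
  ultimately show ?thesis using sH by blast
qed

text \<open>For \<open>X\<close> supported off \<open>e\<close> this is the block sum of the
  one-dimensional block \<open>c\<close> at \<open>e\<close> and of \<open>X\<close>.\<close>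

definition blk :: "'i \<Rightarrow> complex \<Rightarrow> ('i \<Rightarrow> 'i \<Rightarrow> complex) \<Rightarrow> ('i \<Rightarrow> 'i \<Rightarrow> complex)" where
  "blk e c X = (\<lambda>a b. if a = e \<and> b = e then c else X a b)"

lemma mmul_blk:
  assumes "finite F" "e \<notin> F" "supp F X" "supp F Y"
  shows "mmul (insert e F) (blk e c X) (blk e c' Y) = blk e (c * c') (mmul F X Y)"
proof (intro ext)
  fix a b
  have "mmul (insert e F) (blk e c X) (blk e c' Y) a b
      = blk e c X a e * blk e c' Y e b + (\<Sum>x\<in>F. X a x * Y x b)"
    using assms(1,2) unfolding mmul_def
    by (simp, intro sum.cong) (auto simp: blk_def)
  then show "mmul (insert e F) (blk e c X) (blk e c' Y) a b = blk e (c * c') (mmul F X Y) a b"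
    using assms by (auto simp: blk_def supp_def mmul_def)
qed

lemma adj_blk: "adj (blk e c X) = blk e (cnj c) (adj X)"
  by (auto simp: adj_def blk_def fun_eq_iff)

lemma idm_insert: "e \<notin> F \<Longrightarrow> idm (insert e F) = blk e 1 (idm F)"
  by (auto simp: idm_def blk_def fun_eq_iff)

text \<open>Deflation: a Householder reflection moves an eigenvector to the axis \<open>e\<close>.
  Hermiticity leaves only the diagonal entry in row and column \<open>e\<close> of the conjugated
  operator, and the remaining block is diagonalised by induction.\<close>

lemma spectral:
  assumes "finite I" "supp I A" "adj A = A"
  shows "\<exists>U r. supp I U \<and> mmul I (adj U) U = idm I \<and> mmul I U (adj U) = idm I \<and>
    A = mmul I U (mmul I (\<lambda>a b. if a = b \<and> a \<in> I then complex_of_real (r a) else 0) (adj U))"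
  using assms
proof (induction I arbitrary: A rule: finite_induct)
  case empty
  then have "A = (\<lambda>_ _. 0)" by (auto simp: supp_def)
  then show ?case
    by (intro exI[of _ "\<lambda>_ _. 0"]) (auto simp: supp_def mmul_def idm_def)
next
  case (insert e F)
  let ?I = "insert e F"
  have fin: "finite ?I" using insert.hyps by simp
  obtain \<mu> v where v: "(\<Sum>a\<in>?I. (cmod (v a))\<^sup>2) = 1" "\<And>a. a \<notin> ?I \<Longrightarrow> v a = 0"
    and ev: "\<And>a. a \<in> ?I \<Longrightarrow> (\<Sum>b\<in>?I. A a b * v b) = complex_of_real \<mu> * v a"
    using herm_eigenvector[OF fin, of A] insert.prems herm_iff_adj by blast
  obtain H \<gamma> where H: "supp ?I H" "adj H = H" "mmul ?I H H = idm ?I" and Hv: "\<And>a. H a e = \<gamma> * v a"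
    using householder[OF fin _ v] by blast
  define A' where "A' = mmul ?I H (mmul ?I A H)"
  have sA': "supp ?I A'" unfolding A'_def by (intro supp_mmul H insert.prems)
  have aA': "adj A' = A'" unfolding A'_def by (simp add: adj_mmul H insert.prems mmul_assoc)
  have A'e: "A' x e = of_real \<mu> * idm ?I x e" for x
  proof -
    have AH: "mmul ?I A H y e = of_real \<mu> * H y e" if "y \<in> ?I" for y
    proof -
      have "mmul ?I A H y e = \<gamma> * (\<Sum>b\<in>?I. A y b * v b)"
        unfolding mmul_def Hv sum_distrib_left by (intro sum.cong refl) simp
      then show ?thesis by (simp only: ev[OF that] Hv mult.left_commute)
    qed
    have "A' x e = (\<Sum>y\<in>?I. H x y * (of_real \<mu> * H y e))"
      unfolding A'_def mmul_def[of ?I H] by (intro sum.cong refl) (simp only: AH)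
    also have "\<dots> = of_real \<mu> * mmul ?I H H x e"
      unfolding mmul_def sum_distrib_left by (intro sum.cong refl) simp
    finally show ?thesis by (simp only: H(3))
  qed
  have eA': "A' e x = of_real \<mu> * idm ?I x e" for x
  proof -
    have "A' e x = cnj (A' x e)" using fun_cong[OF fun_cong[OF aA', of e], of x] by (simp add: adj_def)
    then show ?thesis by (simp add: A'e idm_def)
  qed
  define A'' where "A'' = (\<lambda>a b. if a \<in> F \<and> b \<in> F then A' a b else 0)"
  have A'blk: "A' = blk e (of_real \<mu>) A''"
  proof (intro ext)
    fix a b
    show "A' a b = blk e (of_real \<mu>) A'' a b"
      using A'e[of a] eA'[of b] sA' insert.hyps(2)
      by (cases "a = e"; cases "b = e") (auto simp: blk_def A''_def idm_def supp_def)
  qed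
  have sA'': "supp F A''" by (simp add: supp_def A''_def)
  have "adj A'' = A''"
  proof (intro ext)
    fix a b
    have "cnj (A' b a) = A' a b" using fun_cong[OF fun_cong[OF aA', of a], of b] by (simp add: adj_def)
    then show "adj A'' a b = A'' a b" by (simp add: adj_def A''_def)
  qed
  from insert.IH[OF sA'' this] obtain U r where U: "supp F U" "mmul F (adj U) U = idm F" "mmul F U (adj U) = idm F"
    and A''U: "A'' = mmul F U (mmul F (\<lambda>a b. if a = b \<and> a \<in> F then complex_of_real (r a) else 0) (adj U))"
    by blast
  define U' where "U' = blk e 1 U"
  define D where "D = (\<lambda>a b. if a = b \<and> a \<in> F then complex_of_real (r a) else 0)"
  define D' where "D' = (\<lambda>a b. if a = b \<and> a \<in> ?I then complex_of_real ((r(e := \<mu>)) a) else 0)"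
  have D'blk: "D' = blk e (of_real \<mu>) D"
    using insert.hyps(2) by (auto simp: D_def D'_def blk_def fun_eq_iff)
  have sD: "supp F D" by (auto simp: supp_def D_def)
  have sU': "supp ?I U'" using U(1) by (auto simp: U'_def blk_def supp_def)
  note blk = mmul_blk[OF insert.hyps(1,2)]
  have U'U: "mmul ?I (adj U') U' = idm ?I" "mmul ?I U' (adj U') = idm ?I"
    by (simp_all add: U'_def adj_blk blk supp_adj U idm_insert insert.hyps(2))
  have A'U: "A' = mmul ?I U' (mmul ?I D' (adj U'))"
    unfolding A'blk U'_def D'blk adj_blk
    by (simp add: blk supp_adj U(1) sD supp_mmul A''U flip: D_def)
  define V where "V = mmul ?I H U'"
  have V1: "mmul ?I (adj V) V = idm ?I"
  proof -
    have "mmul ?I (adj V) V = mmul ?I (adj U') (mmul ?I (mmul ?I H H) U')"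
      by (simp add: V_def adj_mmul H(2) mmul_assoc)
    then show ?thesis by (simp add: H(3) mmul_idm_left[OF fin sU'] U'U)
  qed
  have V2: "mmul ?I V (adj V) = idm ?I"
  proof -
    have "mmul ?I V (adj V) = mmul ?I H (mmul ?I (mmul ?I U' (adj U')) H)"
      by (simp add: V_def adj_mmul H(2) mmul_assoc)
    then show ?thesis by (simp add: H(3) mmul_idm_left[OF fin H(1)] U'U)
  qed
  have "mmul ?I V (mmul ?I D' (adj V)) = mmul ?I H (mmul ?I A' H)"
    by (simp add: V_def A'U adj_mmul H(2) mmul_assoc)
  also have "\<dots> = mmul ?I (mmul ?I H H) (mmul ?I A (mmul ?I H H))"
    by (simp add: A'_def mmul_assoc)
  also have "\<dots> = A"
    unfolding H(3) mmul_idm_right[OF fin insert.prems(1)] mmul_idm_left[OF fin insert.prems(1)] ..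
  finally have "A = mmul ?I V (mmul ?I D' (adj V))" ..
  then show ?case
    using V1 V2 supp_mmul[OF H(1) sU']
    by (intro exI[of _ V] exI[of _ "r(e := \<mu>)"]) (simp add: D'_def V_def)
qed

section \<open>Positive square roots and nonnegativity of the trace norm\<close>

lemma quad_eq_mmul:
  "(\<Sum>a\<in>I. \<Sum>b\<in>I. cnj (v a) * A a b * v b) = mmul I (\<lambda>_ a. cnj (v a)) (mmul I A (\<lambda>a _. v a)) x y"
  by (simp add: mmul_def sum_distrib_left mult.assoc)

text \<open>Vectors become matrices that ignore one index, so that moving \<open>U\<close> from the
  operator to the vectors is just associativity of \<open>mmul\<close>.\<close>

lemma quad_mmul_adj:
  assumes "\<And>a. w a = (\<Sum>x\<in>I. U a x * v x)"
  shows "(\<Sum>a\<in>I. \<Sum>b\<in>I. cnj (v a) * mmul I (adj U) (mmul I A U) a b * v b)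
    = (\<Sum>a\<in>I. \<Sum>b\<in>I. cnj (w a) * A a b * w b)"
proof -
  have "mmul I (\<lambda>_ a. cnj (v a)) (adj U) = (\<lambda>_ a. cnj (w a))" "mmul I U (\<lambda>a _. v a) = (\<lambda>a _. w a)"
    by (simp_all add: mmul_def adj_def assms mult.commute)
  moreover have "mmul I (\<lambda>_ a. cnj (v a)) (mmul I (mmul I (adj U) (mmul I A U)) (\<lambda>a _. v a))
     = mmul I (mmul I (\<lambda>_ a. cnj (v a)) (adj U)) (mmul I A (mmul I U (\<lambda>a _. v a)))"
    by (simp only: mmul_assoc)
  ultimately show ?thesis by (simp only: quad_eq_mmul[where x = undefined and y = undefined])
qed

lemma psd_conj:
  assumes A: "psd I A" and s: "supp I A" and U: "supp I U"
  shows "psd I (mmul I (adj U) (mmul I A U))"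
proof -
  have "adj A = A" using A herm_iff_adj[OF s] by (simp add: psd_def)
  then have "herm I (mmul I (adj U) (mmul I A U))"
    using s U by (subst herm_iff_adj) (auto intro!: supp_mmul supp_adj simp: adj_mmul mmul_assoc)
  then show ?thesis
    unfolding psd_def using psd_quad_nonneg[OF A] by (simp only: quad_mmul_adj[OF refl] simp_thms)
qed

text \<open>In an eigenbasis the root is the diagonal of the numbers \<open>sqrt (r a)\<close>. Any
  other positive root, conjugated by \<open>U\<close>, squares to the same diagonal matrix, so
  \<open>psd_sqrt_diag_unique\<close> forces agreement.\<close>

lemma psd_sqrt_ex1:
  assumes I: "finite I" and A: "psd I A" and s: "supp I A"
  shows "\<exists>!B. psd I B \<and> supp I B \<and> mmul I B B = A"
proof -
  have "adj A = A" using A herm_iff_adj[OF s] by (simp add: psd_def)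
  from spectral[OF I s this] obtain U r where U: "supp I U" "mmul I (adj U) U = idm I" "mmul I U (adj U) = idm I"
    and AU: "A = mmul I U (mmul I (\<lambda>a b. if a = b \<and> a \<in> I then complex_of_real (r a) else 0) (adj U))"
    by blast
  define D where "D = (\<lambda>r a b. if a = b \<and> a \<in> I then complex_of_real (r a) else 0)"
  have sD: "supp I (D r)" for r by (auto simp: D_def supp_def)
  have DD: "mmul I (D r) (D r') = D (\<lambda>a. r a * r' a)" for r r'
  proof (intro ext)
    fix a b
    have "mmul I (D r) (D r') a b = (\<Sum>x\<in>I. if x = a then D (\<lambda>a. r a * r' a) a b else 0)"
      unfolding mmul_def by (intro sum.cong refl) (auto simp: D_def)
    then show "mmul I (D r) (D r') a b = D (\<lambda>a. r a * r' a) a b" using I by (auto simp: D_def)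
  qed
  have conj: "mmul I (adj U) (mmul I (mmul I U (mmul I X (adj U))) U) = X" if "supp I X" for X
  proof -
    have "mmul I (adj U) (mmul I (mmul I U (mmul I X (adj U))) U)
       = mmul I (mmul I (adj U) U) (mmul I X (mmul I (adj U) U))"
      by (simp add: mmul_assoc)
    then show ?thesis by (simp add: U(2) mmul_idm_left[OF I that] mmul_idm_right[OF I that])
  qed
  have conj': "mmul I U (mmul I (mmul I (adj U) (mmul I X U)) (adj U)) = X" if "supp I X" for X
  proof -
    have "mmul I U (mmul I (mmul I (adj U) (mmul I X U)) (adj U))
       = mmul I (mmul I U (adj U)) (mmul I X (mmul I U (adj U)))"
      by (simp add: mmul_assoc)
    then show ?thesis by (simp add: U(3) mmul_idm_left[OF I that] mmul_idm_right[OF I that])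
  qed
  have AD: "A = mmul I U (mmul I (D r) (adj U))" unfolding D_def by (rule AU)
  have "psd I (D r)"
    using psd_conj[OF A s U(1)] conj[OF sD, of r] unfolding AD[symmetric] by simp
  then have r: "0 \<le> r a" if "a \<in> I" for a
    using psd_diag_nonneg(1)[OF I _ that] that by (fastforce simp: D_def)
  define S where "S = D (\<lambda>a. sqrt (r a))"
  have pS: "psd I S" unfolding S_def D_def using r by (intro psd_diag[OF I]) simp
  have sS: "supp I S" unfolding S_def by (rule sD)
  have SS: "mmul I S S = D r"
    unfolding S_def DD using r by (auto simp: D_def fun_eq_iff)
  define B where "B = mmul I U (mmul I S (adj U))"
  have "psd I B"
    using psd_conj[OF pS sS supp_adj[OF U(1)]] by (simp add: B_def)
  moreover have "supp I B"
    unfolding B_def by (intro supp_mmul supp_adj U(1) sS)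
  moreover have "mmul I B B = A"
  proof -
    have "mmul I B B = mmul I U (mmul I S (mmul I (mmul I (adj U) U) (mmul I S (adj U))))"
      by (simp add: B_def mmul_assoc)
    also have "\<dots> = mmul I U (mmul I (mmul I S S) (adj U))"
      by (simp add: U(2) mmul_assoc mmul_idm_left[OF I] supp_mmul supp_adj sS U(1))
    finally show ?thesis by (simp only: SS AD)
  qed
  moreover have "C = B" if C: "psd I C" "supp I C" "mmul I C C = A" for C
  proof -
    define C' where "C' = mmul I (adj U) (mmul I C U)"
    have sC': "supp I C'" unfolding C'_def by (intro supp_mmul supp_adj U(1) C(2))
    have "mmul I C' C' = mmul I (adj U) (mmul I C (mmul I (mmul I U (adj U)) (mmul I C U)))"
      by (simp add: C'_def mmul_assoc)
    also have "\<dots> = mmul I (adj U) (mmul I (mmul I C C) U)"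
      by (simp add: U(3) mmul_assoc mmul_idm_left[OF I] supp_mmul supp_adj C(2) U(1))
    also have "\<dots> = D r"
      unfolding C(3) using conj[OF sD, of r] unfolding AD[symmetric] .
    finally have sq: "mmul I C' C' = D r" .
    have pC': "psd I C'" unfolding C'_def by (rule psd_conj[OF C(1,2) U(1)])
    have sqD: "mmul I C' C' a b = (if a = b then of_real ((sqrt (r a))\<^sup>2) else 0)"
      if "a \<in> I" "b \<in> I" for a b
      unfolding sq using that r by (simp add: D_def)
    have "C' a b = S a b" for a b
    proof (cases "a \<in> I \<and> b \<in> I")
      case True
      have "C' a b = (if a = b then of_real (sqrt (r a)) else 0)"
        using psd_sqrt_diag_unique[OF I pC', of "\<lambda>a. sqrt (r a)"] sqD r True by simp
      then show ?thesis using True by (simp add: S_def D_def)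
    next
      case False
      then show ?thesis using sC' sS by (auto simp: supp_def)
    qed
    then have "C' = S" by blast
    then show "C = B" using conj'[OF C(2)] by (simp add: B_def C'_def)
  qed
  ultimately show ?thesis by blast
qed

text \<open>Not immediate: \<^const>\<open>opsqrt\<close> is a definite description, so its positivity needs the existence and
  uniqueness of the square root.\<close>
lemma trace_norm_nonneg:
  assumes I: "finite I"
  shows "0 \<le> trace_norm I A"
proof -
  let ?X = "mmul I (adj A) A"
  \<comment> \<open>\<open>opsqrt\<close> constrains its square only on \<open>I\<close>, so
    \<open>A\<close> and the product are cut off outside \<open>I\<close> before the result on
    supported operators applies.\<close>
  define X where "X = (\<lambda>a b. if a \<in> I \<and> b \<in> I then ?X a b else 0)"
  define A0 where "A0 = (\<lambda>a b. if a \<in> I \<and> b \<in> I then A a b else 0)"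
  have sA0: "supp I A0" by (simp add: supp_def A0_def)
  have X: "X = mmul I (adj A0) (mmul I (idm I) A0)"
    unfolding mmul_idm_left[OF I sA0] by (auto simp: X_def mmul_def adj_def A0_def fun_eq_iff)
  have "psd I (idm I)" using psd_diag[OF I, of "\<lambda>_. 1", OF zero_le_one] unfolding idm_def[abs_def] of_real_1 .
  then have "psd I X" unfolding X by (rule psd_conj[OF _ supp_idm sA0])
  moreover have "supp I X" by (simp add: supp_def X_def)
  ultimately have ex: "\<exists>!B. psd I B \<and> supp I B \<and> mmul I B B = X" by (rule psd_sqrt_ex1[OF I])
  have "(psd I B \<and> supp I B \<and> mmul I B B = X) \<longleftrightarrow>
      (psd I B \<and> (\<forall>a b. (a \<notin> I \<or> b \<notin> I) \<longrightarrow> B a b = 0) \<and> (\<forall>a\<in>I. \<forall>b\<in>I. mmul I B B a b = ?X a b))" for B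
  proof -
    have "mmul I B B = X \<longleftrightarrow> (\<forall>a\<in>I. \<forall>b\<in>I. mmul I B B a b = ?X a b)" if "supp I B"
      using supp_mmul[OF that that] by (auto simp: X_def fun_eq_iff supp_def)
    then show ?thesis unfolding supp_def by blast
  qed
  then have "opsqrt I ?X = (THE B. psd I B \<and> supp I B \<and> mmul I B B = X)"
    unfolding opsqrt_def by simp
  then have "psd I (opsqrt I ?X)" using theI'[OF ex] by simp
  then have "0 \<le> Re (opsqrt I ?X a a)" if "a \<in> I" for a using psd_diag_nonneg(1)[OF I _ that] by blast
  then show ?thesis by (simp add: trace_norm_def trace_def sum_nonneg)
qed

subsection \<open>Averages over random tuples\<close>

lemma cube_Suc: "cube (Suc k) d = (\<lambda>(x, xs). x # xs) ` ({..<d} \<times> cube k d)"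
  by (auto simp: cube_def length_Suc_conv image_iff)

lemma cube_0 [simp]: "cube 0 d = {[]}"
  by (auto simp: cube_def)

lemma finite_cube [simp]: "finite (cube k d)"
  by (induction k) (auto simp: cube_Suc)

lemma cube_nth: "xs \<in> cube k d \<Longrightarrow> l < k \<Longrightarrow> xs ! l < d"
  by (auto simp: cube_def)

lemma cube_length: "xs \<in> cube k d \<Longrightarrow> length xs = k"
  by (auto simp: cube_def)

lemma sum_cube_Suc: "(\<Sum>xs\<in>cube (Suc k) d. g xs) = (\<Sum>x<d. \<Sum>xs\<in>cube k d. g (x # xs))"
proof -
  have "(\<Sum>xs\<in>cube (Suc k) d. g xs) = (\<Sum>(x, xs)\<in>{..<d} \<times> cube k d. g (x # xs))"
    unfolding cube_Suc by (subst sum.reindex) (auto simp: inj_on_def case_prod_unfold)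
  then show ?thesis by (simp add: sum.cartesian_product)
qed

lemma sum_cube_prod:
  fixes f :: "nat \<Rightarrow> nat \<Rightarrow> 'a :: comm_semiring_1"
  shows "(\<Sum>xs\<in>cube k d. \<Prod>l<k. f l (xs ! l)) = (\<Prod>l<k. \<Sum>x<d. f l x)"
proof (induction k arbitrary: f)
  case (Suc k)
  show ?case
    by (simp add: sum_cube_Suc prod.lessThan_Suc_shift Suc.IH[of "\<lambda>l. f (Suc l)"]
        del: prod.lessThan_Suc flip: sum_distrib_left sum_distrib_right)
qed simp

lemma finite_tuples [simp]: "finite (tuples n k E)"
  by (rule finite_subset[OF _ finite_lists_length_eq[of "{..<n}" k]]) (auto simp: tuples_def)

lemma card_tuples:
  assumes "E \<subseteq> {..<n}" "k + card E \<le> n"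
  shows "card (tuples n k E) = \<Prod>{n - card E - k + 1..n - card E}"
proof -
  have "finite E" using assms finite_subset by blast
  then have c: "card ({..<n} - E) = n - card E" using assms by (simp add: card_Diff_subset)
  then show ?thesis
    unfolding tuples_def using card_lists_distinct_length_eq[of "{..<n} - E" k] assms by simp
qed

lemma card_tuples_pos:
  assumes "E \<subseteq> {..<n}" "k + card E \<le> n"
  shows "0 < card (tuples n k E)"
  unfolding card_tuples[OF assms] by (rule prod_pos) auto

lemma tuplesD:
  assumes "js \<in> tuples n m E"
  shows "length js = m" "distinct js" "set js \<subseteq> {..<n}" "set js \<inter> E = {}" "card (set js) = m"
  using assms by (auto simp: tuples_def distinct_card)

text \<open>Cutting a tuple of length \<open>m + k\<close> after \<open>m\<close> entries is a
  bijection onto the pairs of disjoint tuples.\<close>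

lemma sum_tuples_append:
  "(\<Sum>js\<in>tuples n m {}. \<Sum>is\<in>tuples n k (set js). \<phi> js is)
     = (\<Sum>L\<in>tuples n (m + k) {}. \<phi> (take m L) (drop m L))"
proof -
  have "(\<Sum>js\<in>tuples n m {}. \<Sum>is\<in>tuples n k (set js). \<phi> js is)
     = (\<Sum>(js, is)\<in>Sigma (tuples n m {}) (\<lambda>js. tuples n k (set js)). \<phi> js is)"
    by (rule sum.Sigma) auto
  also have "\<dots> = (\<Sum>L\<in>tuples n (m + k) {}. \<phi> (take m L) (drop m L))"
  proof (rule sum.reindex_bij_witness[of _ "\<lambda>L. (take m L, drop m L)" "\<lambda>(js, is). js @ is"])
    fix L assume "L \<in> tuples n (m + k) {}"
    then show "(take m L, drop m L) \<in> Sigma (tuples n m {}) (\<lambda>js. tuples n k (set js))"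
      using set_take_disj_set_drop_if_distinct[of L m m]
      by (auto simp: tuples_def dest: in_set_takeD in_set_dropD)
  qed (auto simp: tuples_def)
  finally show ?thesis .
qed

definition tavg :: "nat \<Rightarrow> nat \<Rightarrow> (nat list \<Rightarrow> real) \<Rightarrow> real" where
  "tavg n m \<phi> = (\<Sum>js\<in>tuples n m {}. \<phi> js) / real (card (tuples n m {}))"

text \<open>All \<open>js\<close> have the same number of completions, so drawing \<open>js\<close>
  and then \<open>is\<close> uniformly amounts to drawing one uniform tuple of length
  \<open>m + k\<close>.\<close>

lemma tavg_append:
  assumes mk: "m + k \<le> n"
  shows "(\<Sum>js\<in>tuples n m {}. (\<Sum>is\<in>tuples n k (set js). \<phi> js is) / real (card (tuples n k (set js))))
       / real (card (tuples n m {}))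
     = tavg n (m + k) (\<lambda>L. \<phi> (take m L) (drop m L))"
proof -
  \<comment> \<open>Only the size of the excluded set enters \<open>card_tuples\<close>, so
    \<open>{..<m}\<close> can stand for any \<open>set js\<close>.\<close>
  define K where "K = card (tuples n k {..<m})"
  have K: "card (tuples n k (set js)) = K" if "js \<in> tuples n m {}" for js
    unfolding K_def using tuplesD[OF that] mk by (subst (1 2) card_tuples) auto
  have "K > 0" unfolding K_def using mk by (intro card_tuples_pos) auto
  have "card (tuples n (m + k) {}) = card (tuples n m {}) * K"
    using sum_tuples_append[where n = n and m = m and k = k and \<phi> = "\<lambda>_ _. 1::nat"] K by simp
  then show ?thesis
    unfolding tavg_def sum_tuples_append[symmetric]
    using K by (simp add: mult.commute flip: sum_divide_distrib)
qed

lemma tavg_take: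
  assumes "m + k \<le> n"
  shows "tavg n (m + k) (\<lambda>L. \<phi> (take m L)) = tavg n m \<phi>"
proof -
  have "(\<Sum>is\<in>tuples n k (set js). \<phi> js) / real (card (tuples n k (set js))) = \<phi> js"
    if "js \<in> tuples n m {}" for js
    using card_tuples_pos[of "set js" n k] tuplesD[OF that] assms by (simp add: card_gt_0_iff)
  then show ?thesis
    unfolding tavg_append[OF assms, of "\<lambda>js is. \<phi> js", symmetric] by (simp add: tavg_def)
qed

text \<open>Exchangeability: transposing two positions is an involution of the set of
  tuples.\<close>

lemma tavg_swap:
  assumes "i < m" "j < m"
  shows "tavg n m (\<lambda>L. \<phi> (L[i := L ! j, j := L ! i])) = tavg n m \<phi>"
proof -
  have "(\<Sum>L\<in>tuples n m {}. \<phi> (L[i := L ! j, j := L ! i])) = (\<Sum>L\<in>tuples n m {}. \<phi> L)"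
    by (rule sum.reindex_bij_witness[of _ "\<lambda>L. L[i := L ! j, j := L ! i]" "\<lambda>L. L[i := L ! j, j := L ! i]"])
      (use assms in \<open>auto simp: tuples_def list_eq_iff_nth_eq nth_list_update\<close>)
  then show ?thesis by (simp add: tavg_def)
qed

lemma tavg_cong: "(\<And>L. L \<in> tuples n m {} \<Longrightarrow> \<phi> L = \<psi> L) \<Longrightarrow> tavg n m \<phi> = tavg n m \<psi>"
  by (simp add: tavg_def)

lemma tavg_mono: "(\<And>L. L \<in> tuples n m {} \<Longrightarrow> \<phi> L \<le> \<psi> L) \<Longrightarrow> tavg n m \<phi> \<le> tavg n m \<psi>"
  by (auto simp: tavg_def intro!: divide_right_mono sum_mono)

lemma tavg_diff: "tavg n m (\<lambda>L. \<phi> L - \<psi> L) = tavg n m \<phi> - tavg n m \<psi>"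
  by (simp add: tavg_def sum_subtractf diff_divide_distrib)

lemma tavg_cmult: "tavg n m (\<lambda>L. c * \<phi> L) = c * tavg n m \<phi>"
  by (simp add: tavg_def flip: sum_distrib_left)

lemma tavg_sum: "tavg n m (\<lambda>L. \<Sum>l\<in>A. \<phi> l L) = (\<Sum>l\<in>A. tavg n m (\<phi> l))"
  unfolding tavg_def sum_divide_distrib by (rule sum.swap)

lemma tavg_const: "m \<le> n \<Longrightarrow> tavg n m (\<lambda>_. c) = c"
  using card_tuples_pos[of "{}" n m] by (simp add: tavg_def card_gt_0_iff)

lemma sum_lessThan_add:
  fixes f :: "nat \<Rightarrow> 'a :: comm_monoid_add"
  shows "(\<Sum>m<t + l. f m) = (\<Sum>m<t. f m) + (\<Sum>m<l. f (t + m))"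
  by (induction l) (auto simp: add.assoc)

subsection \<open>Entropy of finite distributions\<close>

text \<open>Cauchy--Schwarz with \<open>|p - q| = |sqrt p - sqrt q| (sqrt p + sqrt q)\<close> reduces this to
  \<open>ln x \<le> x - 1\<close> at \<open>x = sqrt (q / p)\<close>.\<close>
lemma sq_l1_dist_le_KL:
  fixes p q :: "'a \<Rightarrow> real"
  assumes Y: "finite Y" and p: "\<And>y. y \<in> Y \<Longrightarrow> 0 \<le> p y" and q: "\<And>y. y \<in> Y \<Longrightarrow> 0 \<le> q y"
    and sp: "(\<Sum>y\<in>Y. p y) = 1" and sq: "(\<Sum>y\<in>Y. q y) = 1"
    and ac: "\<And>y. y \<in> Y \<Longrightarrow> 0 < p y \<Longrightarrow> 0 < q y"
  shows "(\<Sum>y\<in>Y. \<bar>p y - q y\<bar>)\<^sup>2 \<le> 4 * (\<Sum>y\<in>Y. p y * ln (p y / q y))"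
proof -
  have a: "\<bar>p y - q y\<bar> = \<bar>sqrt (p y) - sqrt (q y)\<bar> * (sqrt (p y) + sqrt (q y))" if "y \<in> Y" for y
  proof -
    have "p y - q y = (sqrt (p y) - sqrt (q y)) * (sqrt (p y) + sqrt (q y))"
      using p q that by (simp add: algebra_simps)
    then show ?thesis using p q that by (simp add: abs_mult)
  qed
  have fid: "p y - sqrt (p y) * sqrt (q y) \<le> p y * ln (p y / q y) / 2" if y: "y \<in> Y" for y
  proof (cases "p y = 0")
    case False
    then have pos: "0 < p y" "0 < q y" using p[OF y] ac[OF y] by auto
    have "ln (sqrt (q y / p y)) \<le> sqrt (q y / p y) - 1" using pos by (intro ln_le_minus_one) simp
    moreover have "ln (sqrt (q y / p y)) = - ln (p y / q y) / 2"
      using pos by (simp add: ln_sqrt ln_div)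
    ultimately have "p y * (1 - sqrt (q y / p y)) \<le> p y * (ln (p y / q y) / 2)"
      using pos by (intro mult_left_mono) auto
    moreover have "p y * sqrt (q y / p y) = sqrt (p y) * sqrt (q y)"
      using pos by (simp add: real_sqrt_divide field_simps)
    ultimately show ?thesis by (simp add: algebra_simps)
  qed simp
  have "(\<Sum>y\<in>Y. \<bar>p y - q y\<bar>)\<^sup>2 = (\<Sum>y\<in>Y. \<bar>sqrt (p y) - sqrt (q y)\<bar> * (sqrt (p y) + sqrt (q y)))\<^sup>2"
    using a by simp
  also have "\<dots> \<le> (\<Sum>y\<in>Y. \<bar>sqrt (p y) - sqrt (q y)\<bar>\<^sup>2) * (\<Sum>y\<in>Y. (sqrt (p y) + sqrt (q y))\<^sup>2)"
    by (rule Cauchy_Schwarz_ineq_sum)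
  also have "\<dots> \<le> (\<Sum>y\<in>Y. \<bar>sqrt (p y) - sqrt (q y)\<bar>\<^sup>2) * 4"
  proof (intro mult_left_mono sum_nonneg)
    \<comment> \<open>Origin of the constant 4: the bound
      \<open>(x + y)^2 \<le> 2 x^2 + 2 y^2\<close>, summed over two probability vectors.\<close>
    have "(sqrt (p y) + sqrt (q y))\<^sup>2 \<le> 2 * p y + 2 * q y" if y: "y \<in> Y" for y
      using sum_squares_bound[of "sqrt (p y)" "sqrt (q y)"] p[OF y] q[OF y]
      by (simp add: power2_sum)
    then have "(\<Sum>y\<in>Y. (sqrt (p y) + sqrt (q y))\<^sup>2) \<le> (\<Sum>y\<in>Y. 2 * p y + 2 * q y)"
      by (rule sum_mono)
    also have "\<dots> = 4" using sp sq by (simp add: sum.distrib flip: sum_distrib_left)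
    finally show "(\<Sum>y\<in>Y. (sqrt (p y) + sqrt (q y))\<^sup>2) \<le> 4" .
  qed simp
  also have "(\<Sum>y\<in>Y. \<bar>sqrt (p y) - sqrt (q y)\<bar>\<^sup>2) = (\<Sum>y\<in>Y. p y + q y - 2 * (sqrt (p y) * sqrt (q y)))"
    using p q by (intro sum.cong) (auto simp: power2_diff)
  also have "\<dots> = 2 * (\<Sum>y\<in>Y. p y - sqrt (p y) * sqrt (q y))"
    using sp sq by (simp add: sum.distrib sum_subtractf sum_distrib_left algebra_simps)
  also have "\<dots> \<le> 2 * (\<Sum>y\<in>Y. p y * ln (p y / q y) / 2)"
    using fid by (intro mult_left_mono sum_mono) auto
  also have "\<dots> = (\<Sum>y\<in>Y. p y * ln (p y / q y))"
    by (simp flip: sum_divide_distrib)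
  finally show ?thesis by simp
qed

locale finite_distribution =
  fixes Z :: "(nat \<Rightarrow> nat) set" and P :: "(nat \<Rightarrow> nat) \<Rightarrow> real"
  assumes finite_Z: "finite Z" and P_nonneg: "\<And>z. z \<in> Z \<Longrightarrow> 0 \<le> P z" and P_sum: "(\<Sum>z\<in>Z. P z) = 1"
begin

text \<open>The marginal law of the coordinates in \<open>J\<close>, read off through a full
  assignment \<open>z\<close>; no space of partial assignments is introduced.\<close>

definition pr :: "nat set \<Rightarrow> (nat \<Rightarrow> nat) \<Rightarrow> real" where
  "pr J z = (\<Sum>z'\<in>{z'\<in>Z. \<forall>q\<in>J. z' q = z q}. P z')"

text \<open>Shannon entropy of the coordinates in \<open>J\<close>, as an expectation over full
  assignments. Terms with \<open>P z = 0\<close> vanish, and otherwise the logarithm has a positive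
  argument.\<close>

definition entropy :: "nat set \<Rightarrow> real" where
  "entropy J = - (\<Sum>z\<in>Z. P z * ln (pr J z))"

definition prl :: "nat list \<Rightarrow> nat list \<Rightarrow> real" where
  "prl js xs = (\<Sum>z\<in>{z\<in>Z. map z js = xs}. P z)"

lemma pr_ge: "z \<in> Z \<Longrightarrow> P z \<le> pr J z"
  unfolding pr_def using finite_Z P_nonneg by (intro member_le_sum) auto

lemma pr_pos: "z \<in> Z \<Longrightarrow> P z \<noteq> 0 \<Longrightarrow> 0 < pr J z"
  using pr_ge[of z J] P_nonneg[of z] by linarith

lemma prl_nonneg: "0 \<le> prl js xs"
  unfolding prl_def using P_nonneg by (intro sum_nonneg) auto

lemma prl_map: "prl js (map z js) = pr (set js) z"
  unfolding prl_def pr_def by (intro sum.cong) auto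

lemma prl_le:
  assumes "\<And>z. z \<in> Z \<Longrightarrow> map z js = xs \<Longrightarrow> map z js' = xs'"
  shows "prl js xs \<le> prl js' xs'"
  unfolding prl_def using assms finite_Z P_nonneg by (intro sum_mono2) auto

text \<open>Conditional multipartite information (total correlation) of the coordinates
  \<open>is\<close> given those in \<open>J\<close>. The entropy form is the one whose average
  telescopes.\<close>

definition mutual_info :: "nat set \<Rightarrow> nat list \<Rightarrow> real" where
  "mutual_info J is = (\<Sum>l<length is. entropy (insert (is ! l) J) - entropy J)
     - (entropy (J \<union> set is) - entropy J)"

text \<open>In this form it is the expected relative entropy between the conditional joint law and
  the product of the conditional marginals, as the l1 bound requires.\<close>

lemma mutual_info_eq:
  "mutual_info J is = (\<Sum>z\<in>Z. P z * ln ((pr (J \<union> set is) z / pr J z)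
       / (\<Prod>l<length is. pr (insert (is ! l) J) z / pr J z)))"
proof -
  have "P z * ln ((pr (J \<union> set is) z / pr J z) / (\<Prod>l<length is. pr (insert (is ! l) J) z / pr J z))
     = (P z * ln (pr (J \<union> set is) z) - P z * ln (pr J z))
       - (\<Sum>l<length is. P z * ln (pr (insert (is ! l) J) z) - P z * ln (pr J z))"
    if z: "z \<in> Z" for z
  proof (cases "P z = 0")
    case False
    note pos = pr_pos[OF z False]
    have pp: "pr K z \<noteq> 0" for K using pos[of K] by simp
    have "ln (\<Prod>l<length is. pr (insert (is ! l) J) z / pr J z)
        = (\<Sum>l<length is. ln (pr (insert (is ! l) J) z) - ln (pr J z))"
      using pos by (subst ln_prod) (auto simp: ln_div pp)
    then have "ln ((pr (J \<union> set is) z / pr J z) / (\<Prod>l<length is. pr (insert (is ! l) J) z / pr J z))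
      = ln (pr (J \<union> set is) z) - ln (pr J z) - (\<Sum>l<length is. ln (pr (insert (is ! l) J) z) - ln (pr J z))"
      using pos by (subst ln_div) (auto simp: ln_div pp intro!: prod_pos)
    then show ?thesis by (simp add: right_diff_distrib sum_distrib_left)
  qed simp
  then show ?thesis
    by (simp add: mutual_info_def entropy_def sum_subtractf) (subst sum.swap, simp add: sum_distrib_left)
qed

end

text \<open>What the entropy estimate retains of the quantum setting: given other outcomes, the law
  of coordinate \<open>i\<close> is at most \<open>D\<close> times a probability vector
  \<open>w\<close> that depends neither on \<open>i\<close> nor on the conditioning.\<close>

locale dominated_distribution = finite_distribution +
  fixes n N :: nat and w :: "nat \<Rightarrow> real" and D :: real
  assumes Z_range: "\<And>z i. z \<in> Z \<Longrightarrow> i < n \<Longrightarrow> z i < N"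
    and w_nonneg: "\<And>y. y < N \<Longrightarrow> 0 \<le> w y" and w_sum: "(\<Sum>y<N. w y) = 1"
    and D_pos: "0 < D"
    and dominated: "\<And>J i z. J \<subseteq> {..<n} \<Longrightarrow> i < n \<Longrightarrow> i \<notin> J \<Longrightarrow> z \<in> Z \<Longrightarrow>
       pr (insert i J) z \<le> D * w (z i) * pr J z"
begin

definition cross :: "nat \<Rightarrow> real" where
  "cross i = - (\<Sum>z\<in>Z. P z * ln (w (z i)))"

lemma w_pos:
  assumes "z \<in> Z" "P z \<noteq> 0" "i < n"
  shows "0 < w (z i)"
proof -
  have "0 < D * w (z i) * pr {} z"
    using dominated[of "{}" i z] pr_pos[OF assms(1,2), of "{i}"] assms by simp
  then show ?thesis using w_nonneg[OF Z_range[OF assms(1,3)]] by (cases "w (z i) = 0") auto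
qed

text \<open>Taking logarithms in the domination and averaging gives the lower end of the interval
  for the conditional entropy.\<close>

lemma entropy_step_ge:
  assumes "J \<subseteq> {..<n}" "i < n" "i \<notin> J"
  shows "cross i - ln D \<le> entropy (insert i J) - entropy J"
proof -
  have "P z * ln (pr (insert i J) z) - P z * ln (pr J z) \<le> P z * ln D + P z * ln (w (z i))"
    if z: "z \<in> Z" for z
  proof (cases "P z = 0")
    case False
    note pos = pr_pos[OF z False] w_pos[OF z False assms(2)]
    have "ln (pr (insert i J) z) \<le> ln (D * w (z i) * pr J z)"
      using pos dominated[OF assms z] D_pos by (subst ln_le_cancel_iff) auto
    also have "\<dots> = ln D + ln (w (z i)) + ln (pr J z)"
      using pos D_pos by (simp add: ln_mult_pos)
    finally have "P z * (ln (pr (insert i J) z) - ln (pr J z)) \<le> P z * (ln D + ln (w (z i)))"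
      using P_nonneg[OF z] by (intro mult_left_mono) auto
    then show ?thesis by (simp add: algebra_simps)
  qed simp
  then have "(\<Sum>z\<in>Z. P z * ln (pr (insert i J) z) - P z * ln (pr J z))
      \<le> (\<Sum>z\<in>Z. P z * ln D + P z * ln (w (z i)))" by (rule sum_mono)
  also have "\<dots> = ln D + (\<Sum>z\<in>Z. P z * ln (w (z i)))"
    using P_sum by (simp add: sum.distrib flip: sum_distrib_right)
  finally show ?thesis by (simp add: entropy_def cross_def sum_subtractf)
qed

text \<open>Gibbs' inequality; interchanging the sums over z and over the z' that agree with it on J avoids a change of variables to the
  restrictions of z to J and i.\<close>
lemma entropy_step_le:
  assumes "J \<subseteq> {..<n}" "i < n" "i \<notin> J"
  shows "entropy (insert i J) - entropy J \<le> cross i"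
proof -
  let ?K = "insert i J"
  have "P z * ln (w (z i)) - (P z * ln (pr ?K z) - P z * ln (pr J z))
      \<le> P z * (w (z i) * pr J z / pr ?K z) - P z" if z: "z \<in> Z" for z
  proof (cases "P z = 0")
    case False
    note pos = pr_pos[OF z False] w_pos[OF z False assms(2)]
    have "ln (w (z i)) - (ln (pr ?K z) - ln (pr J z)) = ln (w (z i) * pr J z / pr ?K z)"
      using pos by (simp add: ln_mult_pos ln_div less_imp_neq[symmetric])
    also have "\<dots> \<le> w (z i) * pr J z / pr ?K z - 1"
      using pos by (intro ln_le_minus_one) auto
    finally have "P z * (ln (w (z i)) - (ln (pr ?K z) - ln (pr J z))) \<le> P z * (w (z i) * pr J z / pr ?K z - 1)"
      using P_nonneg[OF z] by (intro mult_left_mono) auto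
    then show ?thesis by (simp add: algebra_simps)
  qed simp
  then have "(\<Sum>z\<in>Z. P z * ln (w (z i)) - (P z * ln (pr ?K z) - P z * ln (pr J z)))
      \<le> (\<Sum>z\<in>Z. P z * (w (z i) * pr J z / pr ?K z) - P z)" by (rule sum_mono)
  also have "\<dots> = (\<Sum>z\<in>Z. P z * (w (z i) * pr J z / pr ?K z)) - 1"
    using P_sum by (simp add: sum_subtractf)
  also have "(\<Sum>z\<in>Z. P z * (w (z i) * pr J z / pr ?K z))
      = (\<Sum>z\<in>Z. \<Sum>z'\<in>Z. if \<forall>q\<in>J. z' q = z q then P z' * (P z * w (z i) / pr ?K z) else 0)"
    unfolding pr_def[of J] using finite_Z
    by (intro sum.cong refl)
      (simp add: sum_distrib_left sum_divide_distrib sum.inter_filter mult_ac, intro sum.cong refl, auto)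
  also have "\<dots> = (\<Sum>z'\<in>Z. \<Sum>z\<in>Z. if \<forall>q\<in>J. z' q = z q then P z' * (P z * w (z i) / pr ?K z) else 0)"
    by (rule sum.swap)
  also have "\<dots> \<le> (\<Sum>z'\<in>Z. P z')"
  proof (rule sum_mono)
    fix z' assume z': "z' \<in> Z"
    let ?A = "{z\<in>Z. \<forall>q\<in>J. z' q = z q}"
    \<comment> \<open>On this class \<open>pr ?K z\<close> is the constant \<open>S\<close>, the
      mass of the class itself, so the quotients sum to 1, or to 0 if \<open>S = 0\<close>, as
      division by zero gives 0.\<close>
    have inner: "(\<Sum>z\<in>{z\<in>?A. z i = y}. P z / pr ?K z) \<le> 1" for y
    proof -
      let ?B = "{z\<in>?A. z i = y}"
      define S where "S = (\<Sum>z\<in>?B. P z)"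
      have "pr ?K z = S" if "z \<in> ?B" for z
        unfolding pr_def S_def using that by (intro sum.cong) auto
      then have "(\<Sum>z\<in>?B. P z / pr ?K z) = (\<Sum>z\<in>?B. P z / S)" by (intro sum.cong) auto
      also have "\<dots> = S / S" unfolding S_def by (rule sum_divide_distrib[symmetric])
      also have "\<dots> \<le> 1" by simp
      finally show ?thesis .
    qed
    have "(\<Sum>z\<in>?A. P z * w (z i) / pr ?K z)
        = (\<Sum>y<N. \<Sum>z\<in>{z\<in>?A. z i = y}. P z * w (z i) / pr ?K z)"
      using finite_Z Z_range assms(2) by (intro sum.group[symmetric]) auto
    also have "\<dots> = (\<Sum>y<N. w y * (\<Sum>z\<in>{z\<in>?A. z i = y}. P z / pr ?K z))"
      unfolding sum_distrib_left by (intro sum.cong refl) auto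
    also have "\<dots> \<le> (\<Sum>y<N. w y * 1)"
      using inner w_nonneg by (intro sum_mono mult_left_mono) auto
    finally have le: "P z' * (\<Sum>z\<in>?A. P z * w (z i) / pr ?K z) \<le> P z' * 1"
      using P_nonneg[OF z'] w_sum by (intro mult_left_mono) auto
    have "(\<Sum>z\<in>Z. if \<forall>q\<in>J. z' q = z q then P z' * (P z * w (z i) / pr ?K z) else 0)
        = P z' * (\<Sum>z\<in>?A. P z * w (z i) / pr ?K z)"
      using finite_Z by (simp add: sum.inter_filter sum_distrib_left, intro sum.cong refl, simp)
    with le show "(\<Sum>z\<in>Z. if \<forall>q\<in>J. z' q = z q then P z' * (P z * w (z i) / pr ?K z) else 0) \<le> P z'"
      by simp
  qed
  finally show ?thesis using P_sum by (simp add: entropy_def cross_def sum_subtractf)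
qed

section \<open>Average entropies, entropy rates and the telescoping sum\<close>

definition avg_entropy :: "nat \<Rightarrow> real" where
  "avg_entropy m = tavg n m (\<lambda>L. entropy (set L))"

text \<open>This is \<open>f(m)\<close> of the overview: by the chain rule, the averaged conditional
  entropy of one more outcome given \<open>m\<close> others.\<close>

definition entropy_rate :: "nat \<Rightarrow> real" where
  "entropy_rate m = avg_entropy (Suc m) - avg_entropy m"

text \<open>By exchangeability the entry at position \<open>m\<close> has the law of the first one.
  Hence the averaged cross entropy is a single constant, which cancels when two rates are
  subtracted.\<close>

lemma tavg_nth:
  assumes "m < n"
  shows "tavg n (Suc m) (\<lambda>L. \<phi> (L ! m)) = tavg n 1 (\<lambda>L. \<phi> (L ! 0))"
proof -
  have "tavg n (Suc m) (\<lambda>L. \<phi> (L ! m)) = tavg n (Suc m) (\<lambda>L. \<phi> (L[0 := L ! m, m := L ! 0] ! 0))"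
    by (intro tavg_cong) (auto simp: tuples_def nth_list_update)
  also have "\<dots> = tavg n (1 + m) (\<lambda>L. \<phi> (take 1 L ! 0))"
    by (subst tavg_swap[where \<phi> = "\<lambda>L. \<phi> (L ! 0)"]) auto
  also have "\<dots> = tavg n 1 (\<lambda>L. \<phi> (L ! 0))"
    using assms by (intro tavg_take) auto
  finally show ?thesis .
qed

lemma entropy_rate_diff_le:
  assumes m: "m < n" and m': "m' < n"
  shows "entropy_rate m - entropy_rate m' \<le> ln D"
proof -
  define c where "c = tavg n 1 (\<lambda>L. cross (L ! 0))"
  have rate: "entropy_rate l = tavg n (Suc l) (\<lambda>L. entropy (insert (L ! l) (set (take l L))) - entropy (set (take l L)))"
    if "l < n" for l
  proof -
    have "avg_entropy l = tavg n (Suc l) (\<lambda>L. entropy (set (take l L)))"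
      unfolding avg_entropy_def using tavg_take[of l 1 n "\<lambda>L. entropy (set L)"] that by simp
    moreover have "avg_entropy (Suc l) = tavg n (Suc l) (\<lambda>L. entropy (insert (L ! l) (set (take l L))))"
      unfolding avg_entropy_def
    proof (rule tavg_cong)
      fix L assume "L \<in> tuples n (Suc l) {}"
      then have "length L = Suc l" by (simp add: tuples_def)
      then have "L = take l L @ [L ! l]" using take_Suc_conv_app_nth[of l L] by simp
      then have "set L = insert (L ! l) (set (take l L))"
        by (metis Un_insert_right list.simps(15) set_append sup_bot.right_neutral list.set(1))
      then show "entropy (set L) = entropy (insert (L ! l) (set (take l L)))" by simp
    qed
    ultimately show ?thesis by (simp add: entropy_rate_def tavg_diff)
  qed
  have side: "set (take l L) \<subseteq> {..<n}" "L ! l < n" "L ! l \<notin> set (take l L)"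
    if L: "L \<in> tuples n (Suc l) {}" for L l
  proof -
    note t = tuplesD[OF L]
    show "set (take l L) \<subseteq> {..<n}" using t by (auto dest: in_set_takeD)
    show "L ! l < n" using t(1,3) nth_mem[of l L] by (auto simp del: nth_mem)
    show "L ! l \<notin> set (take l L)"
      using t by (auto simp: in_set_conv_nth nth_eq_iff_index_eq)
  qed
  have "entropy_rate m \<le> tavg n (Suc m) (\<lambda>L. cross (L ! m))"
    unfolding rate[OF m] using side by (intro tavg_mono entropy_step_le) auto
  moreover have "tavg n (Suc m') (\<lambda>L. cross (L ! m') - ln D) \<le> entropy_rate m'"
    unfolding rate[OF m'] using side by (intro tavg_mono entropy_step_ge) auto
  moreover have "tavg n (Suc m') (\<lambda>L. cross (L ! m') - ln D) = c - ln D"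
    unfolding tavg_diff c_def using tavg_nth[OF m', of cross] m' by (simp add: tavg_const)
  ultimately show ?thesis using tavg_nth[OF m, of cross] by (simp add: c_def)
qed

definition avg_info :: "nat \<Rightarrow> nat \<Rightarrow> real" where
  "avg_info m k = tavg n (m + k) (\<lambda>L. mutual_info (set (take m L)) (drop m L))"

text \<open>On average each single conditional entropy in \<open>mutual_info\<close> is the rate at
  \<open>m\<close>, while the joint one splits by the chain rule into the rates at \<open>m\<close>
  up to \<open>m + k - 1\<close>.\<close>

lemma avg_info_eq:
  assumes mk: "m + k \<le> n"
  shows "avg_info m k = (\<Sum>l<k. entropy_rate m - entropy_rate (m + l))"
proof -
  let ?av = "tavg n (m + k)"
  have 1: "?av (\<lambda>L. entropy (set (take m L))) = avg_entropy m"
    unfolding avg_entropy_def by (rule tavg_take[OF mk])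
  \<comment> \<open>Transposing positions \<open>m\<close> and \<open>m + l\<close> moves the chosen
    entry next to the prefix, which turns the set into that of a prefix of length
    \<open>Suc m\<close>.\<close>
  have 2: "?av (\<lambda>L. entropy (insert (L ! (m + l)) (set (take m L)))) = avg_entropy (Suc m)" if l: "l < k" for l
  proof -
    have "?av (\<lambda>L. entropy (insert (L ! (m + l)) (set (take m L))))
        = ?av (\<lambda>L. entropy (set (take (Suc m) (L[m := L ! (m + l), m + l := L ! m]))))"
    proof (rule tavg_cong)
      fix L assume "L \<in> tuples n (m + k) {}"
      then have "length L = m + k" by (simp add: tuples_def)
      then have "take (Suc m) (L[m := L ! (m + l), m + l := L ! m]) = take m L @ [L ! (m + l)]"
        using l by (subst take_Suc_conv_app_nth) (auto simp: nth_list_update)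
      then show "entropy (insert (L ! (m + l)) (set (take m L)))
         = entropy (set (take (Suc m) (L[m := L ! (m + l), m + l := L ! m])))" by simp
    qed
    also have "\<dots> = ?av (\<lambda>L. entropy (set (take (Suc m) L)))"
      using l by (intro tavg_swap[where \<phi> = "\<lambda>L. entropy (set (take (Suc m) L))"]) auto
    also have "\<dots> = avg_entropy (Suc m)"
      unfolding avg_entropy_def using tavg_take[of "Suc m" "k - 1" n] mk l by simp
    finally show ?thesis .
  qed
  have 3: "avg_entropy (m + k) - avg_entropy m = (\<Sum>l<k. entropy_rate (m + l))"
    unfolding entropy_rate_def using sum_lessThan_telescope[of "\<lambda>l. avg_entropy (m + l)" k] by simp
  have "avg_info m k = ?av (\<lambda>L. (\<Sum>l<k. entropy (insert (L ! (m + l)) (set (take m L))) - entropy (set (take m L)))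
      - (entropy (set L) - entropy (set (take m L))))"
    unfolding avg_info_def
  proof (rule tavg_cong)
    fix L assume "L \<in> tuples n (m + k) {}"
    then have "length L = m + k" by (simp add: tuples_def)
    moreover have "set (take m L) \<union> set (drop m L) = set L" by (metis append_take_drop_id set_append)
    ultimately show "mutual_info (set (take m L)) (drop m L)
      = (\<Sum>l<k. entropy (insert (L ! (m + l)) (set (take m L))) - entropy (set (take m L)))
      - (entropy (set L) - entropy (set (take m L)))"
      unfolding mutual_info_def by simp
  qed
  also have "\<dots> = (\<Sum>l<k. avg_entropy (Suc m) - avg_entropy m) - (avg_entropy (m + k) - avg_entropy m)"
    by (simp add: tavg_diff tavg_sum 1 2 avg_entropy_def[of "m + k"])
  also have "\<dots> = (\<Sum>l<k. entropy_rate m - entropy_rate (m + l))"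
    unfolding 3 by (simp add: sum_subtractf entropy_rate_def[of m])
  finally show ?thesis .
qed

text \<open>If every \<open>m < t\<close> failed, the sum over \<open>m\<close> would exceed k^2 ln
  D; but for each \<open>l\<close> that sum collapses to \<open>l\<close> differences of
  rates.\<close>

lemma exists_small_avg_info:
  assumes D: "1 \<le> D" and t: "1 \<le> t" "t + k \<le> n"
  shows "\<exists>m<t. avg_info m k \<le> (real k)\<^sup>2 * ln D / real t"
proof (rule ccontr)
  assume "\<not> ?thesis"
  then have "(\<Sum>m<t. (real k)\<^sup>2 * ln D / real t) < (\<Sum>m<t. avg_info m k)"
    using t by (intro sum_strict_mono) (auto simp: not_le lessThan_empty_iff)
  also have "\<dots> = (\<Sum>m<t. \<Sum>l<k. entropy_rate m - entropy_rate (m + l))"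
    using t by (intro sum.cong refl avg_info_eq) auto
  also have "\<dots> = (\<Sum>l<k. \<Sum>m<t. entropy_rate m - entropy_rate (m + l))"
    by (rule sum.swap)
  also have "\<dots> = (\<Sum>l<k. \<Sum>m<l. entropy_rate m - entropy_rate (t + m))"
  proof (rule sum.cong[OF refl])
    fix l
    \<comment> \<open>The sum of the first \<open>t + l\<close> rates is split in two ways; this
      also works for \<open>l\<close> beyond \<open>t\<close>.\<close>
    show "(\<Sum>m<t. entropy_rate m - entropy_rate (m + l)) = (\<Sum>m<l. entropy_rate m - entropy_rate (t + m))"
      using sum_lessThan_add[of entropy_rate t l] sum_lessThan_add[of entropy_rate l t]
      by (simp add: sum_subtractf add.commute)
  qed
  \<comment> \<open>The rate at \<open>t + m\<close> is admissible: \<open>m < l < k\<close> and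
    \<open>t + k \<le> n\<close> give \<open>t + m < n\<close>.\<close>
  also have "\<dots> \<le> (\<Sum>l<k. \<Sum>m<l. ln D)"
    using t by (intro sum_mono entropy_rate_diff_le) auto
  also have "\<dots> \<le> (\<Sum>l<k. real k * ln D)"
    using D by (intro sum_mono) (auto intro!: mult_right_mono)
  also have "\<dots> = (real k)\<^sup>2 * ln D" by (simp add: power2_eq_square)
  finally show False using t by simp
qed

section \<open>From information to distances between conditional laws\<close>

lemma map_in_cube: "z \<in> Z \<Longrightarrow> set js \<subseteq> {..<n} \<Longrightarrow> map z js \<in> cube (length js) N"
  using Z_range by (auto simp: cube_def)

lemma sum_prl_append:
  assumes isn: "set is \<subseteq> {..<n}" and len: "length xs = length js"
  shows "(\<Sum>ys\<in>cube (length is) N. prl (js @ is) (xs @ ys)) = prl js xs"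
proof -
  have "prl (js @ is) (xs @ ys) = (\<Sum>z\<in>{z\<in>{z\<in>Z. map z js = xs}. map z is = ys}. P z)" for ys
    unfolding prl_def using len by (intro sum.cong) auto
  moreover have "(\<Sum>ys\<in>cube (length is) N. \<Sum>z\<in>{z\<in>{z\<in>Z. map z js = xs}. map z is = ys}. P z)
      = (\<Sum>z\<in>{z\<in>Z. map z js = xs}. P z)"
    using isn finite_Z by (intro sum.group) (auto intro: map_in_cube)
  ultimately show ?thesis by (simp add: prl_def[of js])
qed

lemma sum_conditional:
  assumes "set is \<subseteq> {..<n}" "length xs = length js" "prl js xs \<noteq> 0"
  shows "(\<Sum>ys\<in>cube (length is) N. prl (js @ is) (xs @ ys) / prl js xs) = 1"
  using sum_prl_append[OF assms(1,2)] assms(3) by (simp flip: sum_divide_distrib)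

lemma sum_conditional_prod:
  assumes isn: "set is \<subseteq> {..<n}" and len: "length xs = length js" and nz: "prl js xs \<noteq> 0"
  shows "(\<Sum>ys\<in>cube (length is) N. \<Prod>l<length is. prl (js @ [is ! l]) (xs @ [ys ! l]) / prl js xs) = 1"
proof -
  have "(\<Sum>y<N. prl (js @ [is ! l]) (xs @ [y]) / prl js xs) = 1" if "l < length is" for l
    using sum_conditional[of "[is ! l]", OF _ len nz] isn nth_mem[OF that]
    by (auto simp: sum_cube_Suc)
  then show ?thesis
    using sum_cube_prod[of "\<lambda>l y. prl (js @ [is ! l]) (xs @ [y]) / prl js xs" "length is" N] by simp
qed

text \<open>\<open>sq_l1_dist_le_KL\<close> is applied for each value \<open>xs\<close> of the
  conditioning outcomes; weighting by the probability of \<open>xs\<close> assembles the conditional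
  relative entropies into \<open>mutual_info\<close>.\<close>

lemma sum_sq_l1_dist_le_mutual_info:
  assumes js: "set js \<subseteq> {..<n}" and isn: "set is \<subseteq> {..<n}"
  defines "c \<equiv> \<lambda>xs ys. prl (js @ is) (xs @ ys) / prl js xs"
    and "q \<equiv> \<lambda>xs ys. \<Prod>l<length is. prl (js @ [is ! l]) (xs @ [ys ! l]) / prl js xs"
  shows "(\<Sum>xs\<in>cube (length js) N. prl js xs * (\<Sum>ys\<in>cube (length is) N. \<bar>c xs ys - q xs ys\<bar>)\<^sup>2)
     \<le> 4 * mutual_info (set js) is"
proof -
  let ?k = "length is" and ?m = "length js"
  have main: "prl js xs * (\<Sum>ys\<in>cube ?k N. \<bar>c xs ys - q xs ys\<bar>)\<^sup>2
      \<le> 4 * (\<Sum>ys\<in>cube ?k N. prl (js @ is) (xs @ ys) * ln (c xs ys / q xs ys))"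
    if xs: "xs \<in> cube ?m N" for xs
  proof (cases "prl js xs = 0")
    case True
    \<comment> \<open>A null conditioning event has only null refinements, so both sides are
      0.\<close>
    have "prl (js @ is) (xs @ ys) \<le> prl js xs" for ys
      by (rule prl_le) (use cube_length[OF xs] in auto)
    then have "prl (js @ is) (xs @ ys) = 0" for ys
      using True prl_nonneg by (metis order_antisym)
    then show ?thesis using True by simp
  next
    case False
    then have pos: "0 < prl js xs" using prl_nonneg[of js xs] by simp
    have len: "length xs = length js" using cube_length[OF xs] .
    have "(\<Sum>ys\<in>cube ?k N. \<bar>c xs ys - q xs ys\<bar>)\<^sup>2 \<le> 4 * (\<Sum>ys\<in>cube ?k N. c xs ys * ln (c xs ys / q xs ys))"
    proof (rule sq_l1_dist_le_KL)
      show "(\<Sum>ys\<in>cube ?k N. c xs ys) = 1"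
        unfolding c_def by (rule sum_conditional[OF isn len False])
      show "(\<Sum>ys\<in>cube ?k N. q xs ys) = 1"
        unfolding q_def by (rule sum_conditional_prod[OF isn len False])
    next
      fix ys assume ys: "ys \<in> cube ?k N" and "0 < c xs ys"
      then have p: "0 < prl (js @ is) (xs @ ys)" using pos by (simp add: c_def zero_less_divide_iff)
      \<comment> \<open>Absolute continuity: the joint event refines each marginal event, so none of
        these is null.\<close>
      have "prl (js @ is) (xs @ ys) \<le> prl (js @ [is ! l]) (xs @ [ys ! l])" if "l < ?k" for l
        by (rule prl_le) (use that len cube_length[OF ys] in auto)
      with p have "0 < prl (js @ [is ! l]) (xs @ [ys ! l])" if "l < ?k" for l
        using that by (meson less_le_trans)
      then show "0 < q xs ys" unfolding q_def using pos by (intro prod_pos) auto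
    qed (auto simp: c_def q_def prl_nonneg intro!: prod_nonneg)
    then have "prl js xs * (\<Sum>ys\<in>cube ?k N. \<bar>c xs ys - q xs ys\<bar>)\<^sup>2
        \<le> prl js xs * (4 * (\<Sum>ys\<in>cube ?k N. c xs ys * ln (c xs ys / q xs ys)))"
      using pos by (intro mult_left_mono) auto
    also have "\<dots> = 4 * (\<Sum>ys\<in>cube ?k N. prl js xs * c xs ys * ln (c xs ys / q xs ys))"
      by (simp add: sum_distrib_left mult_ac)
    also have "\<dots> = 4 * (\<Sum>ys\<in>cube ?k N. prl (js @ is) (xs @ ys) * ln (c xs ys / q xs ys))"
      using pos by (simp add: c_def)
    finally show ?thesis .
  qed
  have "(\<Sum>xs\<in>cube ?m N. \<Sum>ys\<in>cube ?k N. prl (js @ is) (xs @ ys) * ln (c xs ys / q xs ys))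
     = (\<Sum>z\<in>Z. P z * ln (c (map z js) (map z is) / q (map z js) (map z is)))" (is "?lhs = _")
  proof -
    \<comment> \<open>Grouping the assignments by their values on \<open>js\<close> and
      \<open>is\<close> makes the double sum an expectation over \<open>z\<close>.\<close>
    have "?lhs = (\<Sum>xs\<in>cube ?m N. \<Sum>ys\<in>cube ?k N. \<Sum>z\<in>{z\<in>{z\<in>Z. map z js = xs}. map z is = ys}.
        P z * ln (c (map z js) (map z is) / q (map z js) (map z is)))"
      unfolding prl_def[of "js @ is"] sum_distrib_right
      by (intro sum.cong refl) (auto simp: cube_def)
    also have "\<dots> = (\<Sum>xs\<in>cube ?m N. \<Sum>z\<in>{z\<in>Z. map z js = xs}.
        P z * ln (c (map z js) (map z is) / q (map z js) (map z is)))"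
      using isn finite_Z by (intro sum.cong refl sum.group) (auto intro: map_in_cube)
    also have "\<dots> = (\<Sum>z\<in>Z. P z * ln (c (map z js) (map z is) / q (map z js) (map z is)))"
      using js finite_Z by (intro sum.group) (auto intro: map_in_cube)
    finally show ?thesis .
  qed
  also have "\<dots> = mutual_info (set js) is"
  proof -
    have "prl (js @ [is ! l]) (map z js @ [z (is ! l)]) = pr (insert (is ! l) (set js)) z" for l z
      using prl_map[of "js @ [is ! l]" z] by simp
    moreover have "prl (js @ is) (map z js @ map z is) = pr (set js \<union> set is) z" for z
      using prl_map[of "js @ is" z] by simp
    ultimately show ?thesis
      unfolding mutual_info_eq c_def q_def by (simp add: prl_map)
  qed
  finally have eq: "(\<Sum>xs\<in>cube ?m N. \<Sum>ys\<in>cube ?k N. prl (js @ is) (xs @ ys) * ln (c xs ys / q xs ys))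
     = mutual_info (set js) is" .
  show ?thesis
    unfolding eq[symmetric] sum_distrib_left[of 4 _ "cube ?m N"] by (rule sum_mono) (rule main)
qed

end

subsection \<open>Traces against product operators\<close>

lemma psd_quad_real:
  assumes "psd I A"
  shows "(\<Sum>a\<in>I. \<Sum>b\<in>I. cnj (v a) * A a b * v b)
       = of_real (Re (\<Sum>a\<in>I. \<Sum>b\<in>I. cnj (v a) * A a b * v b))" (is "?q = _")
proof -
  have "cnj ?q = (\<Sum>a\<in>I. \<Sum>b\<in>I. cnj (v b) * A b a * v a)"
    unfolding cnj_sum
  proof (intro sum.cong refl)
    fix a b assume "a \<in> I" "b \<in> I"
    then have "A b a = cnj (A a b)" using psd_herm[OF assms] by blast
    then show "cnj (cnj (v a) * A a b * v b) = cnj (v b) * A b a * v a" by simp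
  qed
  also have "\<dots> = ?q" by (rule sum.swap)
  finally have "?q \<in> \<real>" by (simp only: Reals_cnj_iff)
  then show ?thesis by (simp only: of_real_Re)
qed

text \<open>The operator inequality \<open>A \<le> tr(A) I\<close>: Cauchy-Schwarz is applied to
  each Gram vector, and the squared norms of the Gram vectors add up to the trace. Applied to a POVM
  element it yields the domination constant \<open>d\<close>.\<close>

lemma psd_trace_bound:
  assumes I: "finite I" and A: "psd I A"
  shows "psd I (\<lambda>a b. (if a = b then of_real (Re (trace I A)) else 0) - A a b)"
proof -
  obtain w where w: "\<And>a b. a \<in> I \<Longrightarrow> b \<in> I \<Longrightarrow> A a b = (\<Sum>s\<in>I. w s a * cnj (w s b))"
    using psd_gram[OF I A] by blast
  have tr: "Re (trace I A) = (\<Sum>s\<in>I. \<Sum>a\<in>I. (cmod (w s a))\<^sup>2)"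
  proof -
    have "trace I A = (\<Sum>a\<in>I. \<Sum>s\<in>I. of_real ((cmod (w s a))\<^sup>2))"
      unfolding trace_def complex_norm_square using w by simp
    also have "\<dots> = (\<Sum>s\<in>I. \<Sum>a\<in>I. of_real ((cmod (w s a))\<^sup>2))" by (rule sum.swap)
    also have "\<dots> = of_real (\<Sum>s\<in>I. \<Sum>a\<in>I. (cmod (w s a))\<^sup>2)" by (simp only: of_real_sum)
    finally show ?thesis by (simp only: Re_complex_of_real)
  qed
  have quad: "0 \<le> Re (\<Sum>a\<in>I. \<Sum>b\<in>I. cnj (v a) * ((if a = b then of_real (Re (trace I A)) else 0) - A a b) * v b)"
    for v :: "'a \<Rightarrow> complex"
  proof -
    define u where "u = (\<lambda>s. \<Sum>b\<in>I. cnj (w s b) * v b)"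
    have "(cmod (u s))\<^sup>2 \<le> (\<Sum>a\<in>I. (cmod (w s a))\<^sup>2) * (\<Sum>a\<in>I. (cmod (v a))\<^sup>2)" for s
    proof -
      have "cmod (u s) \<le> (\<Sum>a\<in>I. cmod (w s a) * cmod (v a))"
        unfolding u_def by (rule order_trans[OF norm_sum]) (simp add: norm_mult)
      then have "(cmod (u s))\<^sup>2 \<le> (\<Sum>a\<in>I. cmod (w s a) * cmod (v a))\<^sup>2"
        by (intro power_mono) auto
      also note Cauchy_Schwarz_ineq_sum
      finally show ?thesis .
    qed
    then have "(\<Sum>s\<in>I. (cmod (u s))\<^sup>2) \<le> Re (trace I A) * (\<Sum>a\<in>I. (cmod (v a))\<^sup>2)"
      unfolding tr sum_distrib_right by (intro sum_mono) simp
    then show ?thesis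
      by (simp only: quad_scalar_minus[OF I] gram_quad[of I A w, OF w] u_def diff_ge_0_iff_ge)
  qed
  moreover have "herm I (\<lambda>a b. (if a = b then of_real (Re (trace I A)) else 0) - A a b)"
    using A by (intro herm_scalar_minus) (simp add: psd_def)
  ultimately show ?thesis unfolding psd_def by blast
qed

lemma psd_cong:
  assumes "psd I A" and eq: "\<And>a b. a \<in> I \<Longrightarrow> b \<in> I \<Longrightarrow> A a b = B a b"
  shows "psd I B"
proof -
  have "(\<Sum>a\<in>I. \<Sum>b\<in>I. cnj (v a) * B a b * v b) = (\<Sum>a\<in>I. \<Sum>b\<in>I. cnj (v a) * A a b * v b)" for v
    by (intro sum.cong refl) (simp add: eq)
  moreover have "herm I B"
    using assms(1) eq unfolding psd_def herm_def by metis
  ultimately show ?thesis using psd_quad_nonneg[OF assms(1)] unfolding psd_def by simp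
qed

lemma psd_id: "finite I \<Longrightarrow> psd I (\<lambda>a b. if a = b then 1 else 0)"
  by (rule psd_cong[OF psd_diag[of I "\<lambda>_. 1"]]) auto

text \<open>The trace of a product operator against \<open>\<rho>\<close>, with one factor at every
  site. Unmeasured sites carry the identity, so marginal probabilities need no partial
  trace.\<close>

definition tens_tr :: "nat \<Rightarrow> nat \<Rightarrow> (nat list \<Rightarrow> nat list \<Rightarrow> complex) \<Rightarrow> (nat \<Rightarrow> nat \<Rightarrow> nat \<Rightarrow> complex) \<Rightarrow> complex" where
  "tens_tr d n \<rho> A = (\<Sum>c\<in>cube n d. \<Sum>c'\<in>cube n d. (\<Prod>q<n. A q (c' ! q) (c ! q)) * \<rho> c c')"

lemma tens_tr_cong:
  assumes "\<And>q a b. q < n \<Longrightarrow> a < d \<Longrightarrow> b < d \<Longrightarrow> A q a b = B q a b"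
  shows "tens_tr d n \<rho> A = tens_tr d n \<rho> B"
  unfolding tens_tr_def using assms
  by (intro sum.cong arg_cong2[of _ _ _ _ "(*)"] prod.cong refl) (auto simp: cube_nth)

text \<open>Gram decompositions of the factors turn the trace into a sum of quadratic forms of rho.\<close>
lemma tens_tr_psd:
  assumes \<rho>: "psd (cube n d) \<rho>" and A: "\<And>q. q < n \<Longrightarrow> psd {..<d} (A q)"
  shows "0 \<le> Re (tens_tr d n \<rho> A)" "tens_tr d n \<rho> A = of_real (Re (tens_tr d n \<rho> A))"
proof -
  have "\<forall>q. \<exists>w. q < n \<longrightarrow> (\<forall>a<d. \<forall>b<d. A q a b = (\<Sum>s<d. w s a * cnj (w s b)))"
  proof
    fix q
    show "\<exists>w. q < n \<longrightarrow> (\<forall>a<d. \<forall>b<d. A q a b = (\<Sum>s<d. w s a * cnj (w s b)))"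
    proof (cases "q < n")
      case True
      then obtain w where "\<forall>a\<in>{..<d}. \<forall>b\<in>{..<d}. A q a b = (\<Sum>s<d. w s a * cnj (w s b))"
        using psd_gram[of "{..<d}" "A q"] A by blast
      then show ?thesis by (intro exI[of _ w]) blast
    qed simp
  qed
  then obtain w where w: "\<And>q a b. q < n \<Longrightarrow> a < d \<Longrightarrow> b < d \<Longrightarrow>
      A q a b = (\<Sum>s<d. w q s a * cnj (w q s b))"
    by metis
  let ?G = "PiE {..<n} (\<lambda>_. {..<d})"
  \<comment> \<open>\<open>g\<close> selects one Gram vector per site, and \<open>W g\<close> is the
    resulting product vector.\<close>
  define W where "W = (\<lambda>g c. \<Prod>q<n. w q (g q) (c ! q))"
  have "tens_tr d n \<rho> A
      = (\<Sum>c\<in>cube n d. \<Sum>c'\<in>cube n d. \<Sum>g\<in>?G. cnj (W g c) * \<rho> c c' * W g c')"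
    unfolding tens_tr_def
  proof (intro sum.cong refl)
    fix c c' assume c: "c \<in> cube n d" "c' \<in> cube n d"
    have "(\<Prod>q<n. A q (c' ! q) (c ! q)) = (\<Prod>q<n. \<Sum>s<d. w q s (c' ! q) * cnj (w q s (c ! q)))"
      using w cube_nth c by (intro prod.cong) auto
    also have "\<dots> = (\<Sum>g\<in>?G. W g c' * cnj (W g c))"
      by (subst prod_sum_PiE) (auto simp: W_def prod.distrib)
    finally show "(\<Prod>q<n. A q (c' ! q) (c ! q)) * \<rho> c c' = (\<Sum>g\<in>?G. cnj (W g c) * \<rho> c c' * W g c')"
      by (simp add: sum_distrib_left sum_distrib_right mult_ac)
  qed
  also have "\<dots> = (\<Sum>c\<in>cube n d. \<Sum>g\<in>?G. \<Sum>c'\<in>cube n d. cnj (W g c) * \<rho> c c' * W g c')"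
    by (intro sum.cong refl sum.swap)
  also have "\<dots> = (\<Sum>g\<in>?G. \<Sum>c\<in>cube n d. \<Sum>c'\<in>cube n d. cnj (W g c) * \<rho> c c' * W g c')"
    by (rule sum.swap)
  also have "\<dots> = (\<Sum>g\<in>?G. of_real (Re (\<Sum>c\<in>cube n d. \<Sum>c'\<in>cube n d. cnj (W g c) * \<rho> c c' * W g c')))"
    by (intro sum.cong refl psd_quad_real[OF \<rho>])
  finally have eq: "tens_tr d n \<rho> A
      = of_real (\<Sum>g\<in>?G. Re (\<Sum>c\<in>cube n d. \<Sum>c'\<in>cube n d. cnj (W g c) * \<rho> c c' * W g c'))"
    by (simp only: of_real_sum)
  show "0 \<le> Re (tens_tr d n \<rho> A)"
    unfolding eq Re_complex_of_real by (intro sum_nonneg psd_quad_nonneg[OF \<rho>])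
  show "tens_tr d n \<rho> A = of_real (Re (tens_tr d n \<rho> A))"
    unfolding eq Re_complex_of_real ..
qed

text \<open>Linearity in the factor at site \<open>i\<close>, for the kind of combination that the
  domination estimate uses.\<close>

lemma tens_tr_diff:
  assumes i: "i < n"
  shows "tens_tr d n \<rho> (A(i := \<lambda>a b. x * B a b - C a b))
     = x * tens_tr d n \<rho> (A(i := B)) - tens_tr d n \<rho> (A(i := C))"
proof -
  have "(\<Prod>q<n. (A(i := X)) q (c' ! q) (c ! q))
      = X (c' ! i) (c ! i) * (\<Prod>q\<in>{..<n} - {i}. A q (c' ! q) (c ! q))" for X c c'
    using i by (subst prod.remove[of _ i]) (auto intro!: arg_cong2[of _ _ _ _ "(*)"] prod.cong)
  then show ?thesis
    by (simp only: tens_tr_def) (simp add: algebra_simps sum_subtractf sum_distrib_left)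
qed

lemma sum_tens_tr:
  assumes "\<And>q. q < n \<Longrightarrow> finite (S q)"
  shows "(\<Sum>z\<in>PiE {..<n} S. tens_tr d n \<rho> (\<lambda>q. M (z q))) = tens_tr d n \<rho> (\<lambda>q a b. \<Sum>x\<in>S q. M x a b)"
proof -
  have "tens_tr d n \<rho> (\<lambda>q a b. \<Sum>x\<in>S q. M x a b)
      = (\<Sum>c\<in>cube n d. \<Sum>c'\<in>cube n d. \<Sum>z\<in>PiE {..<n} S. (\<Prod>q<n. M (z q) (c' ! q) (c ! q)) * \<rho> c c')"
    unfolding tens_tr_def using assms by (subst prod_sum_PiE) (auto simp: sum_distrib_right)
  also have "\<dots> = (\<Sum>c\<in>cube n d. \<Sum>z\<in>PiE {..<n} S. \<Sum>c'\<in>cube n d. (\<Prod>q<n. M (z q) (c' ! q) (c ! q)) * \<rho> c c')"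
    by (intro sum.cong refl sum.swap)
  also have "\<dots> = (\<Sum>z\<in>PiE {..<n} S. tens_tr d n \<rho> (\<lambda>q. M (z q)))"
    unfolding tens_tr_def by (rule sum.swap)
  finally show ?thesis ..
qed

lemma prod_eq_delta:
  assumes "length a = k" "length b = k"
  shows "(\<Prod>l<k. if a ! l = b ! l then 1 else 0) = (if a = b then 1 else (0 :: 'a :: comm_semiring_1))"
proof (cases "a = b")
  case False
  then obtain l where "l < k" "a ! l \<noteq> b ! l" using assms by (auto simp: list_eq_iff_nth_eq)
  then show ?thesis using False by (subst prod.remove[of _ l]) auto
qed simp

lemma sum_cube_prod2:
  fixes f :: "nat \<Rightarrow> nat \<Rightarrow> nat \<Rightarrow> 'a :: comm_semiring_1"
  shows "(\<Sum>a\<in>cube k d. \<Sum>b\<in>cube k d. \<Prod>l<k. f l (a ! l) (b ! l)) = (\<Prod>l<k. \<Sum>x<d. \<Sum>y<d. f l x y)"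
proof -
  have "(\<Sum>b\<in>cube k d. \<Prod>l<k. f l (a ! l) (b ! l)) = (\<Prod>l<k. \<Sum>y<d. f l (a ! l) y)" for a
    by (rule sum_cube_prod)
  then show ?thesis using sum_cube_prod[of "\<lambda>l x. \<Sum>y<d. f l x y"] by simp
qed

lemma sum_swap_pairs:
  "(\<Sum>a\<in>A. \<Sum>b\<in>B. \<Sum>c\<in>C. \<Sum>c'\<in>C'. g a b c c') = (\<Sum>c\<in>C. \<Sum>c'\<in>C'. \<Sum>a\<in>A. \<Sum>b\<in>B. g a b c c')"
proof -
  have "(\<Sum>a\<in>A. \<Sum>b\<in>B. \<Sum>c\<in>C. \<Sum>c'\<in>C'. g a b c c')
      = (\<Sum>a\<in>A. \<Sum>c\<in>C. \<Sum>b\<in>B. \<Sum>c'\<in>C'. g a b c c')"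
    by (intro sum.cong refl sum.swap)
  also have "\<dots> = (\<Sum>c\<in>C. \<Sum>a\<in>A. \<Sum>b\<in>B. \<Sum>c'\<in>C'. g a b c c')"
    by (rule sum.swap)
  also have "\<dots> = (\<Sum>c\<in>C. \<Sum>a\<in>A. \<Sum>c'\<in>C'. \<Sum>b\<in>B. g a b c c')"
    by (intro sum.cong refl sum.swap)
  also have "\<dots> = (\<Sum>c\<in>C. \<Sum>c'\<in>C'. \<Sum>a\<in>A. \<Sum>b\<in>B. g a b c c')"
    by (intro sum.cong refl sum.swap)
  finally show ?thesis .
qed

text \<open>Testing a partial trace against a product operator amounts to inserting its factors at
  the sites \<open>is\<close> of the full trace. Statistics of conditional states thereby become
  joint outcome probabilities.\<close>

lemma marg_append:
  assumes len: "length Ms = length js" "length Bs = length is" and isn: "set is \<subseteq> {..<n}"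
  shows "(\<Sum>a\<in>cube (length is) d. \<Sum>b\<in>cube (length is) d. tensorl Bs a b * marg d n js Ms is \<rho> b a)
     = marg d n (js @ is) (Ms @ Bs) [] \<rho> [] []"
proof -
  let ?k = "length is"
  define X where "X = (\<lambda>c c'. if \<forall>q<n. q \<notin> set is \<and> q \<notin> set js \<longrightarrow> c ! q = c' ! q
      then (\<Prod>l<length js. (Ms ! l) (c' ! (js ! l)) (c ! (js ! l))) * \<rho> c c' else 0)"
  \<comment> \<open>\<open>pk c\<close> reads off the entries of \<open>c\<close> at
    \<open>is\<close>; the conditions in \<open>marg\<close> are two deltas, which fix
    \<open>b\<close> to \<open>pk c\<close> and \<open>a\<close> to \<open>pk c'\<close>.\<close>
  define pk where "pk = (\<lambda>c::nat list. map ((!) c) is)"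
  have pk: "pk c \<in> cube ?k d" if "c \<in> cube n d" for c
    using that isn by (auto simp: pk_def cube_def)
  have m: "marg d n js Ms is \<rho> b a = (\<Sum>c\<in>cube n d. \<Sum>c'\<in>cube n d. if b = pk c then if a = pk c' then X c c' else 0 else 0)"
    if "a \<in> cube ?k d" "b \<in> cube ?k d" for a b
    unfolding marg_def using cube_length[OF that(1)] cube_length[OF that(2)]
    by (intro sum.cong refl) (auto simp: X_def pk_def list_eq_iff_nth_eq)
  have "(\<Sum>a\<in>cube ?k d. \<Sum>b\<in>cube ?k d. tensorl Bs a b * marg d n js Ms is \<rho> b a)
    = (\<Sum>a\<in>cube ?k d. \<Sum>b\<in>cube ?k d. \<Sum>c\<in>cube n d. \<Sum>c'\<in>cube n d.
        if b = pk c then if a = pk c' then tensorl Bs a b * X c c' else 0 else 0)"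
    by (intro sum.cong refl) (auto simp: m sum_distrib_left intro!: sum.cong)
  also have "\<dots> = (\<Sum>c\<in>cube n d. \<Sum>c'\<in>cube n d. \<Sum>a\<in>cube ?k d. \<Sum>b\<in>cube ?k d.
        if b = pk c then if a = pk c' then tensorl Bs a b * X c c' else 0 else 0)"
    by (rule sum_swap_pairs)
  also have "\<dots> = (\<Sum>c\<in>cube n d. \<Sum>c'\<in>cube n d. tensorl Bs (pk c') (pk c) * X c c')"
    by (intro sum.cong refl) (simp add: pk)
  also have "\<dots> = marg d n (js @ is) (Ms @ Bs) [] \<rho> [] []"
    unfolding marg_def
  proof (intro sum.cong refl)
    fix c c' assume "c \<in> cube n d" "c' \<in> cube n d"
    have "(\<Prod>l<length js + ?k. ((Ms @ Bs) ! l) (c' ! ((js @ is) ! l)) (c ! ((js @ is) ! l)))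
      = (\<Prod>l<length js. (Ms ! l) (c' ! (js ! l)) (c ! (js ! l))) * tensorl Bs (pk c') (pk c)"
    proof -
      have *: "(\<Prod>l<m + k. g l) = (\<Prod>l<m. g l) * (\<Prod>l<k. g (m + l))" for g :: "nat \<Rightarrow> complex" and m k
        by (induction k) (auto simp: mult.assoc)
      show ?thesis
        unfolding * tensorl_def len
        by (intro arg_cong2[of _ _ _ _ "(*)"] prod.cong refl) (auto simp: nth_append len pk_def)
    qed
    then show "tensorl Bs (pk c') (pk c) * X c c' = (if (\<forall>l<length []. c ! ([] ! l) = [] ! l \<and> c' ! ([] ! l) = [] ! l) \<and>
        (\<forall>q<n. q \<notin> set [] \<and> q \<notin> set (js @ is) \<longrightarrow> c ! q = c' ! q)
        then (\<Prod>l<length (js @ is). ((Ms @ Bs) ! l) (c' ! ((js @ is) ! l)) (c ! ((js @ is) ! l))) * \<rho> c c' else 0)"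
      by (auto simp: X_def)
  qed
  finally show ?thesis .
qed

lemma nth_less: "l < length js \<Longrightarrow> set js \<subseteq> {..<n} \<Longrightarrow> js ! l < n"
  by (meson lessThan_iff nth_mem subsetD)

lemma cnj_marg:
  assumes \<rho>: "herm (cube n d) \<rho>" and Ms: "\<And>l. l < length js \<Longrightarrow> herm {..<d} (Ms ! l)"
    and js: "set js \<subseteq> {..<n}"
  shows "cnj (marg d n js Ms is \<rho> a b) = marg d n js Ms is \<rho> b a"
proof -
  have "cnj (marg d n js Ms is \<rho> a b) = (\<Sum>c'\<in>cube n d. \<Sum>c\<in>cube n d.
      cnj (if (\<forall>l<length is. c ! (is ! l) = a ! l \<and> c' ! (is ! l) = b ! l) \<and>
         (\<forall>q<n. q \<notin> set is \<and> q \<notin> set js \<longrightarrow> c ! q = c' ! q)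
      then (\<Prod>l<length js. (Ms ! l) (c' ! (js ! l)) (c ! (js ! l))) * \<rho> c c'
      else 0))"
    unfolding marg_def cnj_sum by (rule sum.swap)
  also have "\<dots> = marg d n js Ms is \<rho> b a"
    unfolding marg_def
  proof (intro sum.cong refl)
    fix c c' assume c: "c' \<in> cube n d" "c \<in> cube n d"
    have "\<rho> c' c = cnj (\<rho> c c')" using \<rho> c unfolding herm_def by blast
    moreover have "(\<Prod>l<length js. (Ms ! l) (c ! (js ! l)) (c' ! (js ! l)))
        = cnj (\<Prod>l<length js. (Ms ! l) (c' ! (js ! l)) (c ! (js ! l)))"
      unfolding cnj_prod
    proof (rule prod.cong[OF refl])
      fix l assume l: "l \<in> {..<length js}"
      then have "js ! l < n" using js by (auto intro: nth_less)
      then show "(Ms ! l) (c ! (js ! l)) (c' ! (js ! l)) = cnj ((Ms ! l) (c' ! (js ! l)) (c ! (js ! l)))"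
        using Ms[of l] l cube_nth c unfolding herm_def by blast
    qed
    ultimately show "cnj (if (\<forall>l<length is. c ! (is ! l) = a ! l \<and> c' ! (is ! l) = b ! l) \<and>
         (\<forall>q<n. q \<notin> set is \<and> q \<notin> set js \<longrightarrow> c ! q = c' ! q)
      then (\<Prod>l<length js. (Ms ! l) (c' ! (js ! l)) (c ! (js ! l))) * \<rho> c c' else 0)
     = (if (\<forall>l<length is. c' ! (is ! l) = b ! l \<and> c ! (is ! l) = a ! l) \<and>
         (\<forall>q<n. q \<notin> set is \<and> q \<notin> set js \<longrightarrow> c' ! q = c ! q)
      then (\<Prod>l<length js. (Ms ! l) (c ! (js ! l)) (c' ! (js ! l))) * \<rho> c' c else 0)"
      by auto
  qed
  finally show ?thesis .
qed

section \<open>Trace and trace norm of measured operators\<close>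

lemma trace_norm_meas_channel:
  "trace_norm (cube k N) (meas_channel d N M k \<xi>) = (\<Sum>ys\<in>cube k N. cmod (meas_channel d N M k \<xi> ys ys))"
  by (rule trace_norm_diag) (auto simp: meas_channel_def)

lemma meas_channel_diag:
  "meas_channel d N M k \<xi> ys ys = (\<Sum>a\<in>cube k d. \<Sum>b\<in>cube k d. tensorl (map M ys) a b * \<xi> b a)"
  by (simp add: meas_channel_def trace_def mmul_def)

text \<open>The POVM elements sum to the identity, so measuring preserves the trace. Tracelessness
  of the deviation operator thus reduces to the normalisation of two classical laws.\<close>

lemma trace_eq_sum_meas_channel:
  assumes "is_povm d N M"
  shows "trace (cube k d) \<xi> = (\<Sum>ys\<in>cube k N. meas_channel d N M k \<xi> ys ys)"
proof -
  have res: "(\<Sum>ys\<in>cube k N. tensorl (map M ys) a b) = (if a = b then 1 else 0)"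
    if ab: "a \<in> cube k d" "b \<in> cube k d" for a b
  proof -
    have "(\<Sum>ys\<in>cube k N. tensorl (map M ys) a b) = (\<Sum>ys\<in>cube k N. \<Prod>l<k. M (ys ! l) (a ! l) (b ! l))"
      unfolding tensorl_def by (intro sum.cong refl) (auto simp: cube_length)
    also have "\<dots> = (\<Prod>l<k. \<Sum>y<N. M y (a ! l) (b ! l))" by (rule sum_cube_prod)
    also have "\<dots> = (\<Prod>l<k. if a ! l = b ! l then 1 else 0)"
      using assms cube_nth[OF ab(1)] cube_nth[OF ab(2)] unfolding is_povm_def by (intro prod.cong) auto
    also have "\<dots> = (if a = b then 1 else 0)" using ab by (intro prod_eq_delta) (auto simp: cube_length)
    finally show ?thesis .
  qed
  have "(\<Sum>ys\<in>cube k N. meas_channel d N M k \<xi> ys ys)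
     = (\<Sum>a\<in>cube k d. \<Sum>b\<in>cube k d. (\<Sum>ys\<in>cube k N. tensorl (map M ys) a b) * \<xi> b a)"
  proof -
    have "(\<Sum>ys\<in>cube k N. meas_channel d N M k \<xi> ys ys)
      = (\<Sum>a\<in>cube k d. \<Sum>ys\<in>cube k N. \<Sum>b\<in>cube k d. tensorl (map M ys) a b * \<xi> b a)"
      unfolding meas_channel_diag by (rule sum.swap)
    also have "\<dots> = (\<Sum>a\<in>cube k d. \<Sum>b\<in>cube k d. \<Sum>ys\<in>cube k N. tensorl (map M ys) a b * \<xi> b a)"
      by (intro sum.cong refl sum.swap)
    finally show ?thesis by (simp add: sum_distrib_right)
  qed
  also have "\<dots> = (\<Sum>a\<in>cube k d. \<Sum>b\<in>cube k d. if b = a then \<xi> a a else 0)"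
    by (intro sum.cong refl) (auto simp: res)
  also have "\<dots> = trace (cube k d) \<xi>" by (simp add: trace_def)
  finally show ?thesis ..
qed

subsection \<open>The outcome distribution of a measured state\<close>

locale measured_state =
  fixes d n N :: nat and \<rho> :: "nat list \<Rightarrow> nat list \<Rightarrow> complex" and M :: "nat \<Rightarrow> nat \<Rightarrow> nat \<Rightarrow> complex"
  assumes d_pos: "0 < d" and state: "is_state d n \<rho>" and povm: "is_povm d N M"
begin

lemma psd_\<rho>: "psd (cube n d) \<rho>" and trace_\<rho>: "trace (cube n d) \<rho> = 1"
  using state by (auto simp: is_state_def)

lemma psd_M: "x < N \<Longrightarrow> psd {..<d} (M x)"
  using povm by (auto simp: is_povm_def)

lemma sum_M: "a < d \<Longrightarrow> b < d \<Longrightarrow> (\<Sum>x<N. M x a b) = (if a = b then 1 else 0)"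
  using povm by (auto simp: is_povm_def)

definition outcomes :: "(nat \<Rightarrow> nat) set" where
  "outcomes = PiE {..<n} (\<lambda>_. {..<N})"

definition prob :: "(nat \<Rightarrow> nat) \<Rightarrow> real" where
  "prob z = Re (tens_tr d n \<rho> (\<lambda>q. M (z q)))"

lemma prob:
  assumes "z \<in> outcomes"
  shows "0 \<le> prob z" "tens_tr d n \<rho> (\<lambda>q. M (z q)) = of_real (prob z)"
proof -
  have "psd {..<d} (M (z q))" if "q < n" for q
    using assms that by (intro psd_M) (auto simp: outcomes_def)
  from tens_tr_psd[OF psd_\<rho> this]
  show "0 \<le> prob z" "tens_tr d n \<rho> (\<lambda>q. M (z q)) = of_real (prob z)"
    by (auto simp: prob_def)
qed

text \<open>An event that restricts each coordinate separately is a box, over which the sum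
  factorises site by site. Normalisation and all marginals are instances, with \<open>S q\<close> a
  singleton at measured sites and everything elsewhere.\<close>

lemma sum_prob:
  assumes S: "\<And>q. q < n \<Longrightarrow> S q \<subseteq> {..<N}"
  shows "tens_tr d n \<rho> (\<lambda>q a b. \<Sum>x\<in>S q. M x a b) = of_real (\<Sum>z\<in>PiE {..<n} S. prob z)"
proof -
  have "tens_tr d n \<rho> (\<lambda>q a b. \<Sum>x\<in>S q. M x a b) = (\<Sum>z\<in>PiE {..<n} S. tens_tr d n \<rho> (\<lambda>q. M (z q)))"
    using S by (intro sum_tens_tr[symmetric]) (auto intro: finite_subset)
  also have "\<dots> = (\<Sum>z\<in>PiE {..<n} S. of_real (prob z))"
    using S by (intro sum.cong refl prob(2)) (auto simp: outcomes_def PiE_iff subset_iff)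
  finally show ?thesis by simp
qed

lemma sum_prob_outcomes: "(\<Sum>z\<in>outcomes. prob z) = 1"
proof -
  have "complex_of_real (\<Sum>z\<in>outcomes. prob z) = tens_tr d n \<rho> (\<lambda>q a b. if a = b then 1 else 0)"
    unfolding outcomes_def by (subst sum_prob[symmetric]) (auto simp: sum_M intro!: tens_tr_cong)
  also have "\<dots> = (\<Sum>c\<in>cube n d. \<Sum>c'\<in>cube n d. if c' = c then \<rho> c c else 0)"
    unfolding tens_tr_def by (intro sum.cong refl) (auto simp: prod_eq_delta cube_length)
  also have "\<dots> = 1" using trace_\<rho> by (simp add: trace_def)
  finally show ?thesis by (simp only: of_real_eq_1_iff)
qed

sublocale finite_distribution outcomes prob
  by unfold_locales (auto simp: prob sum_prob_outcomes, auto simp: outcomes_def intro: finite_PiE)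

lemma pr_eq:
  assumes z: "z \<in> outcomes" and J: "J \<subseteq> {..<n}"
  shows "of_real (pr J z) = tens_tr d n \<rho> (\<lambda>q. if q \<in> J then M (z q) else (\<lambda>a b. if a = b then 1 else 0))"
proof -
  let ?S = "\<lambda>q. if q \<in> J then {z q} else {..<N}"
  have "{z' \<in> outcomes. \<forall>q\<in>J. z' q = z q} = PiE {..<n} ?S"
    using z J by (intro set_eqI) (auto simp: outcomes_def PiE_iff subset_iff split: if_splits)
  then have "complex_of_real (pr J z) = tens_tr d n \<rho> (\<lambda>q a b. \<Sum>x\<in>?S q. M x a b)"
    unfolding pr_def using z by (subst sum_prob) (auto simp: outcomes_def PiE_iff)
  also have "\<dots> = tens_tr d n \<rho> (\<lambda>q. if q \<in> J then M (z q) else (\<lambda>a b. if a = b then 1 else 0))"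
    by (rule tens_tr_cong) (auto simp: sum_M)
  finally show ?thesis .
qed

definition weight :: "nat \<Rightarrow> real" where
  "weight y = Re (trace {..<d} (M y)) / real d"

text \<open>Replacing the identity at site \<open>i\<close> by the positive operator
  \<open>tr(M_y) I - M_y\<close> keeps the trace nonnegative, and this is the domination with
  \<open>D = d\<close>.\<close>

sublocale dominated_distribution outcomes prob n N weight "real d"
proof unfold_locales
  show "z \<in> outcomes \<Longrightarrow> i < n \<Longrightarrow> z i < N" for z i by (auto simp: outcomes_def)
  show "0 \<le> weight y" if "y < N" for y
    using psd_diag_nonneg(1)[OF _ psd_M[OF that]]
    by (auto simp: weight_def trace_def intro!: divide_nonneg_nonneg sum_nonneg)
  have "(\<Sum>y<N. Re (trace {..<d} (M y))) = Re (\<Sum>a<d. \<Sum>y<N. M y a a)"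
    unfolding trace_def Re_sum by (rule sum.swap)
  also have "\<dots> = real d" by (simp add: sum_M)
  finally show "(\<Sum>y<N. weight y) = 1"
    using d_pos by (simp add: weight_def flip: sum_divide_distrib)
  show "0 < real d" using d_pos by simp
next
  fix J i z assume J: "J \<subseteq> {..<n}" and i: "i < n" "i \<notin> J" and z: "z \<in> outcomes"
  have zN: "z q < N" if "q < n" for q using z that by (auto simp: outcomes_def)
  let ?id = "\<lambda>a b. if a = b then 1 else (0::complex)"
  let ?t = "Re (trace {..<d} (M (z i)))"
  define A where "A = (\<lambda>q. if q \<in> J then M (z q) else ?id)"
  have AJ: "A(i := ?id) = A" and AI: "A(i := M (z i)) = (\<lambda>q. if q \<in> insert i J then M (z q) else ?id)"
    using i by (auto simp: A_def)
  have eq: "tens_tr d n \<rho> (A(i := \<lambda>a b. of_real ?t * ?id a b - M (z i) a b))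
     = of_real ?t * of_real (pr J z) - of_real (pr (insert i J) z)"
    unfolding tens_tr_diff[OF i(1)] AJ AI using J i by (simp add: pr_eq z A_def)
  have "psd {..<d} (\<lambda>a b. of_real ?t * ?id a b - M (z i) a b)"
    using psd_trace_bound[OF _ psd_M[OF zN[OF i(1)]]] by (simp add: if_distrib cong: if_cong)
  then have "psd {..<d} ((A(i := \<lambda>a b. of_real ?t * ?id a b - M (z i) a b)) q)" (is "psd _ (?A' q)") if "q < n" for q
    using psd_M[OF zN[OF that]] psd_id[of "{..<d}"] by (auto simp: A_def)
  then have "0 \<le> Re (tens_tr d n \<rho> ?A')" by (rule tens_tr_psd(1)[OF psd_\<rho>])
  then have "pr (insert i J) z \<le> ?t * pr J z"
    unfolding eq by simp
  then show "pr (insert i J) z \<le> real d * weight (z i) * pr J z"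
    using d_pos by (simp add: weight_def)
qed

lemma marg_eq_prl:
  assumes js: "distinct js" "set js \<subseteq> {..<n}" and xs: "xs \<in> cube (length js) N"
  shows "marg d n js (map M xs) [] \<rho> [] [] = of_real (prl js xs)"
proof -
  let ?S = "\<lambda>q. {x. x < N \<and> (\<forall>l<length js. js ! l = q \<longrightarrow> x = xs ! l)}"
  have len: "length xs = length js" using cube_length[OF xs] .
  have out: "?S q = {..<N}" if "q \<notin> set js" for q using that by auto
  \<comment> \<open>Distinctness of \<open>js\<close> leaves a single admissible outcome at each
    measured site.\<close>
  have inn: "?S (js ! l) = {xs ! l}" if "l < length js" for l
    using that js(1) cube_nth[OF xs that] by (auto simp: nth_eq_iff_index_eq)
  have "{z\<in>outcomes. map z js = xs} = PiE {..<n} ?S"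
    using nth_less[OF _ js(2)] len
    by (intro set_eqI) (auto simp: outcomes_def PiE_iff list_eq_iff_nth_eq extensional_def)
  then have "complex_of_real (prl js xs) = tens_tr d n \<rho> (\<lambda>q a b. \<Sum>x\<in>?S q. M x a b)"
    unfolding prl_def by (subst sum_prob) auto
  also have "\<dots> = marg d n js (map M xs) [] \<rho> [] []"
    unfolding tens_tr_def marg_def
  proof (intro sum.cong refl)
    fix c c' assume c: "c \<in> cube n d" "c' \<in> cube n d"
    let ?f = "\<lambda>q. \<Sum>x\<in>?S q. M x (c' ! q) (c ! q)"
    have "(\<Prod>q<n. ?f q) = (\<Prod>q\<in>{..<n} - set js. ?f q) * (\<Prod>q\<in>set js. ?f q)"
      using js(2) by (intro prod.subset_diff) auto
    also have "(\<Prod>q\<in>set js. ?f q) = (\<Prod>l<length js. ?f (js ! l))"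
      using prod.reindex_bij_betw[OF bij_betw_nth[OF js(1) refl refl], of ?f] by simp
    also have "\<dots> = (\<Prod>l<length js. (map M xs ! l) (c' ! (js ! l)) (c ! (js ! l)))"
      using inn len by (intro prod.cong refl) simp
    also have "(\<Prod>q\<in>{..<n} - set js. ?f q) = (\<Prod>q\<in>{..<n} - set js. if c ! q = c' ! q then 1 else 0)"
    proof (rule prod.cong[OF refl])
      fix q assume q: "q \<in> {..<n} - set js"
      then have "?f q = (\<Sum>x<N. M x (c' ! q) (c ! q))" using out by auto
      then show "?f q = (if c ! q = c' ! q then 1 else 0)" using q c by (auto simp: sum_M cube_nth)
    qed
    also have "\<dots> = (if \<forall>q<n. q \<notin> set js \<longrightarrow> c ! q = c' ! q then 1 else 0)"
      (is "_ = (if ?R then _ else _)")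
    proof (cases "\<forall>q<n. q \<notin> set js \<longrightarrow> c ! q = c' ! q")
      case True
      then show ?thesis by (auto intro!: prod.neutral)
    next
      case False
      then have "\<exists>q\<in>{..<n} - set js. (if c ! q = c' ! q then 1 else 0) = (0::complex)" by auto
      then have "(\<Prod>q\<in>{..<n} - set js. if c ! q = c' ! q then 1 else 0) = (0::complex)"
        by (intro prod_zero) auto
      then show ?thesis using False by auto
    qed
    finally show "(\<Prod>q<n. ?f q) * \<rho> c c' = (if (\<forall>l<length []. c ! ([] ! l) = [] ! l \<and> c' ! ([] ! l) = [] ! l) \<and>
        (\<forall>q<n. q \<notin> set [] \<and> q \<notin> set js \<longrightarrow> c ! q = c' ! q)
        then (\<Prod>l<length js. (map M xs ! l) (c' ! (js ! l)) (c ! (js ! l))) * \<rho> c c' else 0)"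
      by auto
  qed
  finally show ?thesis ..
qed

lemma outcome_prob_eq:
  assumes "distinct js" "set js \<subseteq> {..<n}" "xs \<in> cube (length js) N"
  shows "outcome_prob d n M js xs \<rho> = prl js xs"
  using marg_eq_prl[OF assms] by (simp add: outcome_prob_def)

text \<open>By \<open>marg_append\<close> the unnormalised statistics are joint outcome
  probabilities; the normalisation in \<open>post_red\<close> makes them conditional.\<close>

lemma meas_channel_post_red:
  assumes js: "distinct (js @ is)" "set (js @ is) \<subseteq> {..<n}" and xs: "xs \<in> cube (length js) N"
    and ys: "ys \<in> cube (length is) N"
  shows "meas_channel d N M (length is) (post_red d n M js xs is \<rho>) ys ys
     = of_real (prl (js @ is) (xs @ ys) / prl js xs)"
proof -
  have len: "length xs = length js" "length ys = length is" using cube_length xs ys by auto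
  have "meas_channel d N M (length is) (post_red d n M js xs is \<rho>) ys ys
     = marg d n (js @ is) (map M xs @ map M ys) [] \<rho> [] [] / of_real (outcome_prob d n M js xs \<rho>)"
    unfolding meas_channel_diag post_red_def
    using js len by (subst marg_append[symmetric]) (auto simp: sum_divide_distrib)
  also have "\<dots> = of_real (prl (js @ is) (xs @ ys) / prl js xs)"
    using js xs ys marg_eq_prl[of "js @ is" "xs @ ys"] by (auto simp: outcome_prob_eq cube_def)
  finally show ?thesis .
qed

lemma meas_channel_product:
  assumes js: "distinct (js @ is)" "set (js @ is) \<subseteq> {..<n}" and xs: "xs \<in> cube (length js) N"
    and ys: "ys \<in> cube (length is) N"
  shows "meas_channel d N M (length is) (tensorl (map (\<lambda>i. post_red1 d n M js xs i \<rho>) is)) ys ys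
     = of_real (\<Prod>l<length is. prl (js @ [is ! l]) (xs @ [ys ! l]) / prl js xs)"
proof -
  let ?\<sigma> = "\<lambda>i. post_red1 d n M js xs i \<rho>"
  have one: "(\<Sum>x<d. \<Sum>y<d. M (ys ! l) x y * ?\<sigma> (is ! l) y x)
      = of_real (prl (js @ [is ! l]) (xs @ [ys ! l]) / prl js xs)" if l: "l < length is" for l
  proof -
    have "meas_channel d N M (length [is ! l]) (post_red d n M js xs [is ! l] \<rho>) [ys ! l] [ys ! l]
      = of_real (prl (js @ [is ! l]) (xs @ [ys ! l]) / prl js xs)"
      using js l nth_mem[OF l] nth_less[OF l] cube_nth[OF ys l]
      by (intro meas_channel_post_red xs) (auto simp: cube_def)
    then show ?thesis by (simp add: meas_channel_diag sum_cube_Suc tensorl_def post_red1_def)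
  qed
  have "meas_channel d N M (length is) (tensorl (map ?\<sigma> is)) ys ys
    = (\<Sum>a\<in>cube (length is) d. \<Sum>b\<in>cube (length is) d.
        \<Prod>l<length is. M (ys ! l) (a ! l) (b ! l) * ?\<sigma> (is ! l) (b ! l) (a ! l))"
    unfolding meas_channel_diag tensorl_def using cube_length[OF ys] by (simp add: prod.distrib)
  also have "\<dots> = (\<Prod>l<length is. \<Sum>x<d. \<Sum>y<d. M (ys ! l) x y * ?\<sigma> (is ! l) y x)"
    by (rule sum_cube_prod2)
  also have "\<dots> = of_real (\<Prod>l<length is. prl (js @ [is ! l]) (xs @ [ys ! l]) / prl js xs)"
    using one by simp
  finally show ?thesis .
qed

section \<open>Bounding the deviation\<close>

lemma cnj_post_red:
  assumes "set js \<subseteq> {..<n}" "xs \<in> cube (length js) N"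
  shows "cnj (post_red d n M js xs is \<rho> a b) = post_red d n M js xs is \<rho> b a"
proof -
  have "herm {..<d} (map M xs ! l)" if "l < length js" for l
    using psd_M[OF cube_nth[OF assms(2) that]] that cube_length[OF assms(2)] by (simp add: psd_def)
  then show ?thesis
    using cnj_marg[of n d \<rho> js "map M xs" "is" a b] assms psd_\<rho> by (simp add: post_red_def psd_def)
qed

lemma deviation_nonneg: "0 \<le> deviation d n M js xs is \<rho>"
  unfolding deviation_def by (rule trace_norm_nonneg) simp

text \<open>Measuring the deviation operator leaves the difference of the conditional joint law and
  the product law on the diagonal, so distinguishability bounds its trace norm by an l1
  distance.\<close>

lemma deviation_le:
  assumes js: "distinct (js @ is)" "set (js @ is) \<subseteq> {..<n}" and xs: "xs \<in> cube (length js) N"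
    and nz: "prl js xs \<noteq> 0" and K: "0 \<le> K"
    and dist: "\<And>\<xi>. 0 < length is \<Longrightarrow> herm (cube (length is) d) \<xi> \<Longrightarrow> trace (cube (length is) d) \<xi> = 0 \<Longrightarrow>
       trace_norm (cube (length is) d) \<xi> \<le> K * trace_norm (cube (length is) N) (meas_channel d N M (length is) \<xi>)"
  shows "deviation d n M js xs is \<rho> \<le> K * (\<Sum>ys\<in>cube (length is) N.
       \<bar>prl (js @ is) (xs @ ys) / prl js xs - (\<Prod>l<length is. prl (js @ [is ! l]) (xs @ [ys ! l]) / prl js xs)\<bar>)"
proof -
  let ?k = "length is"
  define c where "c = (\<lambda>ys. prl (js @ is) (xs @ ys) / prl js xs)"
  define q where "q = (\<lambda>ys. \<Prod>l<?k. prl (js @ [is ! l]) (xs @ [ys ! l]) / prl js xs)"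
  let ?post = "post_red d n M js xs is \<rho>"
  let ?prod = "tensorl (map (\<lambda>i. post_red1 d n M js xs i \<rho>) is)"
  define \<xi> where "\<xi> = (\<lambda>a b. ?post a b - ?prod a b)"
  have meas: "meas_channel d N M ?k \<xi> ys ys = of_real (c ys - q ys)" if "ys \<in> cube ?k N" for ys
  proof -
    have "meas_channel d N M ?k \<xi> ys ys = meas_channel d N M ?k ?post ys ys - meas_channel d N M ?k ?prod ys ys"
      by (simp add: meas_channel_diag \<xi>_def right_diff_distrib sum_subtractf)
    then show ?thesis
      by (simp only: meas_channel_post_red[OF js xs that] meas_channel_product[OF js xs that] c_def q_def of_real_diff)
  qed
  have herm: "herm (cube ?k d) \<xi>"
    using cnj_post_red[of js xs] js(2) xs
    by (auto simp: herm_def \<xi>_def tensorl_def post_red1_def)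
  have sums: "(\<Sum>ys\<in>cube ?k N. c ys) = 1" "(\<Sum>ys\<in>cube ?k N. q ys) = 1"
    unfolding c_def q_def using js(2) nz cube_length[OF xs]
    by (auto intro!: sum_conditional sum_conditional_prod)
  have "trace (cube ?k d) \<xi> = (\<Sum>ys\<in>cube ?k N. of_real (c ys - q ys))"
    unfolding trace_eq_sum_meas_channel[OF povm] using meas by simp
  also have "\<dots> = of_real ((\<Sum>ys\<in>cube ?k N. c ys) - (\<Sum>ys\<in>cube ?k N. q ys))"
    by (simp add: sum_subtractf)
  finally have tr: "trace (cube ?k d) \<xi> = 0" by (simp add: sums)
  have tn: "trace_norm (cube ?k N) (meas_channel d N M ?k \<xi>) = (\<Sum>ys\<in>cube ?k N. \<bar>c ys - q ys\<bar>)"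
    unfolding trace_norm_meas_channel
    by (intro sum.cong refl) (simp only: meas norm_of_real)
  have "trace_norm (cube ?k d) \<xi> \<le> K * (\<Sum>ys\<in>cube ?k N. \<bar>c ys - q ys\<bar>)"
  proof (cases "?k = 0")
    case True
    \<comment> \<open>Distinguishability is available for positive lengths only; at length 0 the
      space is one-dimensional, where a traceless operator is 0.\<close>
    then have "\<xi> [] [] = 0" using tr by (simp add: trace_def)
    moreover have "trace_norm (cube ?k d) \<xi> = cmod (\<xi> [] [])"
      unfolding True by (subst trace_norm_diag) auto
    ultimately show ?thesis using K by (simp add: sum_nonneg)
  next
    case False
    then show ?thesis using dist[OF _ herm tr] tn by simp
  qed
  then show ?thesis by (simp add: deviation_def \<xi>_def c_def q_def)
qed

text \<open>Interchanging the sums over outcomes and over \<open>is\<close> exposes a nested uniform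
  average, which \<open>tavg_append\<close> merges; the bound then holds for each tuple
  \<open>L\<close> separately.\<close>

lemma avg_dev_sq_le:
  assumes mk: "m + k \<le> n" and K: "0 \<le> K"
    and dist: "\<And>\<xi>. 0 < k \<Longrightarrow> herm (cube k d) \<xi> \<Longrightarrow> trace (cube k d) \<xi> = 0 \<Longrightarrow>
       trace_norm (cube k d) \<xi> \<le> K * trace_norm (cube k N) (meas_channel d N M k \<xi>)"
  shows "avg_dev_sq d n k N M m \<rho> \<le> 4 * K\<^sup>2 * avg_info m k"
proof -
  define F where "F = (\<lambda>js is. \<Sum>xs\<in>cube m N. outcome_prob d n M js xs \<rho> * (deviation d n M js xs is \<rho>)\<^sup>2)"
  have "avg_dev_sq d n k N M m \<rho> = (\<Sum>js\<in>tuples n m {}.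
      (\<Sum>is\<in>tuples n k (set js). F js is) / real (card (tuples n k (set js)))) / real (card (tuples n m {}))"
  proof -
    have "(\<Sum>xs\<in>cube m N. outcome_prob d n M js xs \<rho> * ((\<Sum>is\<in>tuples n k (set js). (deviation d n M js xs is \<rho>)\<^sup>2)
           / real (card (tuples n k (set js)))))
        = (\<Sum>is\<in>tuples n k (set js). F js is) / real (card (tuples n k (set js)))" for js
      unfolding F_def by (subst sum.swap) (simp add: sum_distrib_left sum_divide_distrib)
    then show ?thesis by (simp add: avg_dev_sq_def)
  qed
  also have "\<dots> = tavg n (m + k) (\<lambda>L. F (take m L) (drop m L))"
    by (rule tavg_append[OF mk])
  also have "\<dots> \<le> tavg n (m + k) (\<lambda>L. 4 * K\<^sup>2 * mutual_info (set (take m L)) (drop m L))"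
  proof (rule tavg_mono)
    fix L assume L: "L \<in> tuples n (m + k) {}"
    define js "is" where "js = take m L" and "is = drop m L"
    have "js @ is = L" by (simp add: js_def is_def)
    then have ji: "distinct (js @ is)" "set (js @ is) \<subseteq> {..<n}" and len: "length js = m" "length is = k"
      using tuplesD[OF L] by (auto simp: js_def is_def)
    let ?dist = "\<lambda>xs. \<Sum>ys\<in>cube k N. \<bar>prl (js @ is) (xs @ ys) / prl js xs
        - (\<Prod>l<k. prl (js @ [is ! l]) (xs @ [ys ! l]) / prl js xs)\<bar>"
    have "F js is \<le> (\<Sum>xs\<in>cube m N. K\<^sup>2 * (prl js xs * (?dist xs)\<^sup>2))"
      unfolding F_def
    proof (rule sum_mono)
      fix xs assume xs: "xs \<in> cube m N"
      have op: "outcome_prob d n M js xs \<rho> = prl js xs"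
        using ji xs len by (intro outcome_prob_eq) auto
      show "outcome_prob d n M js xs \<rho> * (deviation d n M js xs is \<rho>)\<^sup>2 \<le> K\<^sup>2 * (prl js xs * (?dist xs)\<^sup>2)"
      \<comment> \<open>For a null outcome the conditional state involves division by zero, but its
        weight 0 removes the term.\<close>
      proof (cases "prl js xs = 0")
        case False
        then have "deviation d n M js xs is \<rho> \<le> K * ?dist xs"
          using deviation_le[OF ji _ _ K, of xs] xs dist len by simp
        \<comment> \<open>Squaring the inequality is the place where nonnegativity of the trace norm
          enters.\<close>
        then have "(deviation d n M js xs is \<rho>)\<^sup>2 \<le> (K * ?dist xs)\<^sup>2"
          using deviation_nonneg by (intro power_mono)
        then have "prl js xs * (deviation d n M js xs is \<rho>)\<^sup>2 \<le> prl js xs * (K * ?dist xs)\<^sup>2"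
          by (intro mult_left_mono prl_nonneg)
        then show ?thesis by (simp add: op power_mult_distrib mult_ac)
      qed (simp add: op)
    qed
    also have "\<dots> = K\<^sup>2 * (\<Sum>xs\<in>cube m N. prl js xs * (?dist xs)\<^sup>2)"
      by (simp only: sum_distrib_left)
    also have "\<dots> \<le> K\<^sup>2 * (4 * mutual_info (set js) is)"
      using sum_sq_l1_dist_le_mutual_info[of js "is"] ji len by (intro mult_left_mono) auto
    finally show "F (take m L) (drop m L) \<le> 4 * K\<^sup>2 * mutual_info (set (take m L)) (drop m L)"
      by (simp add: js_def is_def)
  qed
  also have "\<dots> = 4 * K\<^sup>2 * avg_info m k"
    unfolding avg_info_def by (rule tavg_cmult)
  finally show ?thesis .
qed

end

theorem theorem17:
  fixes d n k N :: nat
    and \<rho> :: "nat list \<Rightarrow> nat list \<Rightarrow> complex"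
    and M :: "nat \<Rightarrow> nat \<Rightarrow> nat \<Rightarrow> complex"
  assumes "d \<ge> 2"
    and "is_state d n \<rho>"
    and "k \<le> n"
    and "is_povm d N M"
    and "N \<le> d ^ 8"
    and "\<forall>k' > 0. \<forall>\<xi>. herm (cube k' d) \<xi> \<and> trace (cube k' d) \<xi> = 0 \<longrightarrow>
           trace_norm (cube k' d) \<xi>
             \<le> (18 * real d) powr (real k' / 2) * trace_norm (cube k' N) (meas_channel d N M k' \<xi>)"
  shows "\<forall>t::nat. 1 \<le> t \<and> t \<le> n - k \<longrightarrow>
           (\<exists>m \<le> t. avg_dev_sq d n k N M m \<rho>
                      \<le> 4 * ln (real d) * (18 * real d) ^ k * (real k)\<^sup>2 / real t)"
proof (intro allI impI)
  fix t :: nat assume t: "1 \<le> t \<and> t \<le> n - k"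
  interpret measured_state d n N \<rho> M
    using assms(1,2,4) by unfold_locales auto
  \<comment> \<open>Here \<open>D\<close> is \<open>d\<close>, and \<open>t + k \<le> n\<close>
    follows from \<open>t \<le> n - k\<close> together with \<open>k \<le> n\<close>, the
    subtraction being truncated.\<close>
  obtain m where m: "m < t" "avg_info m k \<le> (real k)\<^sup>2 * ln (real d) / real t"
    using exists_small_avg_info[of t k] t assms(1,3) by fastforce
  define K where "K = (18 * real d) powr (real k / 2)"
  have K2: "K\<^sup>2 = (18 * real d) ^ k"
    using assms(1) by (simp add: K_def powr_powr powr_realpow flip: powr_numeral)
  have "avg_dev_sq d n k N M m \<rho> \<le> 4 * K\<^sup>2 * avg_info m k"
    using m t assms(6) by (intro avg_dev_sq_le) (auto simp: K_def)
  also have "\<dots> \<le> 4 * K\<^sup>2 * ((real k)\<^sup>2 * ln (real d) / real t)"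
    using m by (intro mult_left_mono) auto
  also have "\<dots> = 4 * ln (real d) * (18 * real d) ^ k * (real k)\<^sup>2 / real t"
    unfolding K2 by (simp add: mult_ac)
  finally show "\<exists>m \<le> t. avg_dev_sq d n k N M m \<rho>
      \<le> 4 * ln (real d) * (18 * real d) ^ k * (real k)\<^sup>2 / real t"
    using m by (intro exI[of _ m]) auto
qed

end
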